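(* For every finite graph $F$ and every integer $k$ with $3\leq k\leq 5$, we have $\mathrm{sat}_k(n,\text{Berge-}F)=O(n)$ as $n\to\infty$ (the implied constant may depend on $F$ and $k$).
   Context: For a graph $F$, a hypergraph $H$ is Berge-$F$ if there is a bijection $\phi:E(F)\to E(H)$ with $e\subseteq\phi(e)$ for all $e\in E(F)$, where $V(F)$ is identified with a subset of $V(H)$; a hypergraph contains a Berge-$F$ if some subhypergraph of it is Berge-$F$. A $k$-uniform hypergraph $H$ on $n$ vertices is Berge-$F$-saturated if it contains no Berge-$F$ but adding any new $k$-element hyperedge creates a hypergraph containing a Berge-$F$. $\mathrm{sat}_k(n,\text{Berge-}F)$ is the minimum number of hyperedges in a $k$-uniform Berge-$F$-saturated hypergraph on $n$ vertices. *)

theory Defs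
  imports Complex_Main "HOL-Library.Landau_Symbols"
begin

text \<open>A hypergraph is a pair of a finite vertex set and a set of hyperedges (no repeated
  hyperedges); a graph is a 2-uniform hypergraph, so it is finite, without loops or multiple
  edges, but possibly with isolated vertices.\<close>

type_synonym 'a hypergraph = "'a set \<times> 'a set set"

abbreviation verts :: "'a hypergraph \<Rightarrow> 'a set" where "verts H \<equiv> fst H"
abbreviation hedges :: "'a hypergraph \<Rightarrow> 'a set set" where "hedges H \<equiv> snd H"

definition hypergraph :: "'a hypergraph \<Rightarrow> bool" where
  "hypergraph H \<longleftrightarrow> finite (verts H) \<and> (\<forall>e\<in>hedges H. e \<subseteq> verts H)"

definition uniform :: "nat \<Rightarrow> 'a hypergraph \<Rightarrow> bool" where
  "uniform k H \<longleftrightarrow> (\<forall>e\<in>hedges H. card e = k)"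

definition graph :: "'a hypergraph \<Rightarrow> bool" where
  "graph F \<longleftrightarrow> hypergraph F \<and> uniform 2 F"

definition subhypergraph :: "'a hypergraph \<Rightarrow> 'a hypergraph \<Rightarrow> bool" where
  "subhypergraph H' H \<longleftrightarrow> hypergraph H' \<and> verts H' \<subseteq> verts H \<and> hedges H' \<subseteq> hedges H"

text \<open>The injection \<open>f\<close> is the identification of the vertex set of \<open>F\<close> with a subset of the
  vertex set of \<open>H\<close>.\<close>

definition is_berge :: "'a hypergraph \<Rightarrow> 'b hypergraph \<Rightarrow> bool" where
  "is_berge F H \<longleftrightarrow>
     (\<exists>f \<phi>. inj_on f (verts F) \<and> f ` verts F \<subseteq> verts H \<and>
            bij_betw \<phi> (hedges F) (hedges H) \<and> (\<forall>e\<in>hedges F. f ` e \<subseteq> \<phi> e))"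

definition contains_berge :: "'a hypergraph \<Rightarrow> 'b hypergraph \<Rightarrow> bool" where
  "contains_berge F H \<longleftrightarrow> (\<exists>H'. subhypergraph H' H \<and> is_berge F H')"

definition berge_saturated :: "nat \<Rightarrow> 'a hypergraph \<Rightarrow> 'b hypergraph \<Rightarrow> bool" where
  "berge_saturated k F H \<longleftrightarrow>
     hypergraph H \<and> uniform k H \<and> \<not> contains_berge F H \<and>
     (\<forall>e. e \<subseteq> verts H \<and> card e = k \<and> e \<notin> hedges H \<longrightarrow>
          contains_berge F (verts H, insert e (hedges H)))"

text \<open>Every finite hypergraph is isomorphic to one whose vertices are natural numbers. The
  infimum is an attained minimum as soon as \<open>F\<close> has an edge (lemma \<open>sat_attained\<close> below). For
  edgeless \<open>F\<close> and \<open>n \<ge> card (verts F)\<close> no saturated hypergraph exists, and the value is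
  \<open>Inf {} = 0\<close>.\<close>

definition berge_sat :: "nat \<Rightarrow> nat \<Rightarrow> 'a hypergraph \<Rightarrow> nat" where
  "berge_sat k n F =
     Inf {card (hedges H) | H :: nat hypergraph. card (verts H) = n \<and> berge_saturated k F H}"

lemma saturated_exists:
  assumes "hedges F \<noteq> {}"
  shows "\<exists>H :: nat hypergraph. card (verts H) = n \<and> berge_saturated k F H"
proof -
  let ?V = "{..<n}"
  let ?K = "{e. e \<subseteq> ?V \<and> card e = k}"
  let ?S = "{E. E \<subseteq> ?K \<and> \<not> contains_berge F (?V, E)}"
  have "finite ?K" by (rule finite_subset[of _ "Pow ?V"]) auto
  then have "finite (Pow ?K)" by simp
  then have fin: "finite ?S" by (rule finite_subset[rotated]) blast
  have "{} \<in> ?S"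
  proof -
    have False if "hedges H' \<subseteq> {}" "bij_betw \<phi> (hedges F) (hedges H')"
      for H' :: "nat hypergraph" and \<phi>
    proof -
      have "hedges H' = {}" using that(1) by (rule subset_empty[THEN iffD1])
      with that(2) have "\<phi> ` hedges F = {}" unfolding bij_betw_def by simp
      with assms show False by simp
    qed
    then have "\<not> contains_berge F (?V, {})"
      unfolding contains_berge_def is_berge_def subhypergraph_def snd_conv by blast
    then show ?thesis by simp
  qed
  then obtain E where E: "E \<in> ?S" and mx: "\<And>E'. E' \<in> ?S \<Longrightarrow> E \<subseteq> E' \<Longrightarrow> E = E'"
    using finite_has_maximal[OF fin] by (metis (no_types, lifting) empty_iff)
  have "contains_berge F (?V, insert e E)" if "e \<subseteq> ?V" "card e = k" "e \<notin> E" for e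
  proof (rule ccontr)
    assume "\<not> contains_berge F (?V, insert e E)"
    with that E have "insert e E \<in> ?S" by auto
    from mx[OF this] that show False by auto
  qed
  with E have "berge_saturated k F (?V, E)"
    by (auto simp: berge_saturated_def hypergraph_def uniform_def)
  then show ?thesis by (intro exI[of _ "(?V, E)"]) auto
qed

lemma sat_attained:
  assumes "hedges F \<noteq> {}"
  shows "\<exists>H :: nat hypergraph. card (verts H) = n \<and> berge_saturated k F H \<and>
           card (hedges H) = berge_sat k n F"
proof -
  let ?A = "{card (hedges H) | H :: nat hypergraph. card (verts H) = n \<and> berge_saturated k F H}"
  have "?A \<noteq> {}" using saturated_exists[OF assms, of n k] by blast
  then have "Inf ?A \<in> ?A" by (rule Inf_nat_def1)
  then obtain H :: "nat hypergraph"
    where "Inf ?A = card (hedges H)" "card (verts H) = n" "berge_saturated k F H"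
    by blast
  then show ?thesis unfolding berge_sat_def by (intro exI[of _ H]) simp
qed

end

theory Submission
  imports Defs
begin

text \<open>Let \<open>u\<close> be the least number of vertices meeting all cycles of \<open>F\<close>, and \<open>\<tau>\<close> the vertex cover
  number. A hypergraph \<open>H\<^sub>0\<close> with \<open>O(n)\<close> hyperedges is built from a core of \<open>u\<close> vertices and
  disjoint blocks of bounded size, so that every vertex of a block is joined to all core vertices
  by \<open>u\<close> distinct hyperedges inside core and block. If \<open>H\<close> contains \<open>H\<^sub>0\<close> and has more than
  \<open>C n\<close> hyperedges, then the hyperedges outside \<open>H\<^sub>0\<close> have a subfamily of large minimum degree off
  the core; a forest \<open>F - A\<close> with \<open>|A| = u\<close> embeds greedily into it, using each block at most once,
  and \<open>H\<^sub>0\<close> joins it to the core. So it suffices that \<open>H\<^sub>0\<close> itself contains no Berge-\<open>F\<close>.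

  If \<open>\<tau> > k\<close>, take a core of \<open>\<tau> - 1\<close> vertices and blocks of size one: the core would cover \<open>F\<close>.
  If \<open>\<tau> \<le> k\<close>, then \<open>u < k\<close>. By minimality of \<open>u\<close>, a Berge-\<open>F\<close> in \<open>H\<^sub>0\<close> has, for every core vertex
  \<open>c\<close>, a cycle inside \<open>c\<close> and a single block. This is impossible if \<open>u \<le> 2\<close>, as a block has only
  \<open>u\<close> hyperedges; if \<open>u \<ge> 3\<close>, these cycles lie in distinct blocks, so \<open>\<tau> \<ge> 2 u \<ge> 6 > k\<close>. The
  cycles can fail to lie in distinct blocks only if \<open>k = 5\<close>, \<open>u = 3\<close> and \<open>F\<close> has a triangle
  component; then a core of two vertices together with one extra Berge triangle works.\<close>

section \<open>Graphs, 2-cores and Berge embeddings\<close>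

definition two_core :: "'a set set \<Rightarrow> 'a set \<Rightarrow> bool" where
  "two_core E S \<longleftrightarrow> S \<noteq> {} \<and>
     (\<forall>x\<in>S. \<exists>y\<in>S. \<exists>z\<in>S. y \<noteq> z \<and> {x, y} \<in> E \<and> {x, z} \<in> E)"

text \<open>\<open>F\<close> restricted to \<open>X\<close> is a forest iff no nonempty subset of \<open>X\<close> induces minimum degree at
  least two; working with such subsets avoids cycles.\<close>

definition acyclic_on :: "'a set set \<Rightarrow> 'a set \<Rightarrow> bool" where
  "acyclic_on E X \<longleftrightarrow> (\<forall>S. S \<subseteq> X \<longrightarrow> \<not> two_core E S)"

definition vertex_cover :: "'a set set \<Rightarrow> 'a set \<Rightarrow> bool" where
  "vertex_cover E W \<longleftrightarrow> (\<forall>e\<in>E. e \<inter> W \<noteq> {})"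

lemma acyclic_on_subset: "acyclic_on E X \<Longrightarrow> Y \<subseteq> X \<Longrightarrow> acyclic_on E Y"
  unfolding acyclic_on_def by blast

lemma graph_edge:
  assumes "graph F" "e \<in> hedges F"
  obtains x y where "e = {x, y}" "x \<noteq> y" "x \<in> verts F" "y \<in> verts F"
proof -
  have "card e = 2" "e \<subseteq> verts F"
    using assms by (auto simp: graph_def hypergraph_def uniform_def)
  then show ?thesis using that by (auto simp: card_2_iff)
qed

lemma graph_finite:
  assumes "graph F"
  shows "finite (verts F)" "finite (hedges F)"
proof -
  show 1: "finite (verts F)" using assms by (simp add: graph_def hypergraph_def)
  have "hedges F \<subseteq> Pow (verts F)" using assms by (auto simp: graph_def hypergraph_def)
  then show "finite (hedges F)" using 1 by (meson finite_Pow_iff finite_subset)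
qed

lemma graph_no_loop: "graph F \<Longrightarrow> {x, y} \<in> hedges F \<Longrightarrow> x \<noteq> y"
  by (auto simp: graph_def uniform_def)

text \<open>Every edge that avoids \<open>W - {w}\<close> contains \<open>w\<close>, so at most a
  star and isolated vertices remain. This is the bound u \<le> \<tau> - 1.\<close>

lemma acyclic_on_cover_minus:
  assumes "graph F" "vertex_cover (hedges F) W"
  shows "acyclic_on (hedges F) (verts F - (W - {w}))"
proof -
  have False if S: "S \<subseteq> verts F - (W - {w})" "two_core (hedges F) S" for S
  proof -
    have nb: "x = w \<or> y = w" if "x \<in> S" "y \<in> S" "{x, y} \<in> hedges F" for x y
    proof -
      have "{x, y} \<inter> W \<noteq> {}" using assms(2) that(3) unfolding vertex_cover_def by (rule bspec)
      then show ?thesis using that(1,2) S(1) by auto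
    qed
    obtain x where "x \<in> S" using S(2) by (auto simp: two_core_def)
    then obtain y where y: "y \<in> S" "{x, y} \<in> hedges F" "x \<noteq> y"
      using S(2) graph_no_loop[OF assms(1)] unfolding two_core_def by blast
    then obtain v where v: "v \<in> S" "v \<noteq> w" using \<open>x \<in> S\<close> by blast
    then obtain p q where "p \<in> S" "q \<in> S" "p \<noteq> q" "{v, p} \<in> hedges F" "{v, q} \<in> hedges F"
      using S(2) unfolding two_core_def by blast
    then show False using nb v by metis
  qed
  then show ?thesis unfolding acyclic_on_def by blast
qed

section \<open>Berge copies as pairs of injections; saturated extensions\<close>

definition berge_emb ::
    "'a hypergraph \<Rightarrow> ('a \<Rightarrow> 'b) \<Rightarrow> ('a set \<Rightarrow> 'b set) \<Rightarrow> 'b hypergraph \<Rightarrow> bool" where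
  "berge_emb F f \<phi> H \<longleftrightarrow> inj_on f (verts F) \<and> f ` verts F \<subseteq> verts H \<and>
     inj_on \<phi> (hedges F) \<and> \<phi> ` hedges F \<subseteq> hedges H \<and> (\<forall>e\<in>hedges F. f ` e \<subseteq> \<phi> e)"

text \<open>The image of \<phi> serves as the hyperedge set of the subhypergraph, on all vertices of
  \<open>H\<close>. A copy is thus just a pair of injections.\<close>

lemma contains_berge_iff:
  assumes "hypergraph H"
  shows "contains_berge F H \<longleftrightarrow> (\<exists>f \<phi>. berge_emb F f \<phi> H)"
proof
  assume "contains_berge F H"
  then obtain H' f \<phi> where "subhypergraph H' H" "inj_on f (verts F)" "f ` verts F \<subseteq> verts H'"
    "bij_betw \<phi> (hedges F) (hedges H')" "\<forall>e\<in>hedges F. f ` e \<subseteq> \<phi> e"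
    unfolding contains_berge_def is_berge_def by auto
  then have "berge_emb F f \<phi> H"
    by (auto simp: berge_emb_def subhypergraph_def bij_betw_def)
  then show "\<exists>f \<phi>. berge_emb F f \<phi> H" by auto
next
  assume "\<exists>f \<phi>. berge_emb F f \<phi> H"
  then obtain f \<phi> where *: "berge_emb F f \<phi> H" by auto
  let ?H = "(verts H, \<phi> ` hedges F)"
  have "subhypergraph ?H H"
    using * assms by (fastforce simp: subhypergraph_def berge_emb_def hypergraph_def image_subset_iff)
  moreover have "is_berge F ?H"
    unfolding is_berge_def
    by (rule exI[of _ f], rule exI[of _ \<phi>]) (use * in \<open>auto simp: berge_emb_def bij_betw_def\<close>)
  ultimately show "contains_berge F H" unfolding contains_berge_def by (intro exI[of _ ?H]) simp
qed

text \<open>Take a maximal family among the families of \<open>k\<close>-sets that contain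
  \<open>E\<^sub>0\<close> and carry no Berge-\<open>F\<close>. A bound for all such families
  therefore bounds \<open>berge_sat\<close>.\<close>

lemma saturated_extends:
  fixes E\<^sub>0 :: "'b set set"
  assumes V: "finite V" and E\<^sub>0: "\<And>e. e \<in> E\<^sub>0 \<Longrightarrow> e \<subseteq> V \<and> card e = k"
    and free: "\<not> contains_berge F (V, E\<^sub>0)"
  shows "\<exists>E. E\<^sub>0 \<subseteq> E \<and> berge_saturated k F (V, E)"
proof -
  let ?K = "{e. e \<subseteq> V \<and> card e = k}"
  let ?S = "{E. E\<^sub>0 \<subseteq> E \<and> E \<subseteq> ?K \<and> \<not> contains_berge F (V, E)}"
  have "finite ?K" by (rule finite_subset[of _ "Pow V"]) (use V in auto)
  then have "finite ?S" by (intro finite_subset[of ?S "Pow ?K"]) auto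
  moreover have "E\<^sub>0 \<in> ?S" using E\<^sub>0 free by auto
  ultimately obtain E where E: "E \<in> ?S" and mx: "\<And>E'. E' \<in> ?S \<Longrightarrow> E \<subseteq> E' \<Longrightarrow> E = E'"
    using finite_has_maximal[of ?S] by (metis (no_types, lifting) empty_iff)
  have "contains_berge F (V, insert e E)" if "e \<subseteq> V" "card e = k" "e \<notin> E" for e
  proof (rule ccontr)
    assume "\<not> contains_berge F (V, insert e E)"
    with that E have "insert e E \<in> ?S" by auto
    from mx[OF this] that show False by auto
  qed
  with E V have "berge_saturated k F (V, E)"
    by (auto simp: berge_saturated_def hypergraph_def uniform_def)
  with E show ?thesis by blast
qed

section \<open>Large minimum degree and greedy embedding of forests\<close>

text \<open>Vertices of \<open>Y\<close> of degree at most \<open>d\<close> are deleted one after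
  another together with their hyperedges. At most \<open>d * card Y\<close> hyperedges are lost, so
  some survive.\<close>

lemma large_min_degree_subfamily:
  assumes "finite Y" "finite \<H>" "card \<H> > d * card Y"
  shows "\<exists>\<H>'\<subseteq>\<H>. \<H>' \<noteq> {} \<and> (\<forall>v\<in>Y \<inter> \<Union>\<H>'. card {e\<in>\<H>'. v \<in> e} > d)"
  using assms
proof (induction "card Y" arbitrary: Y \<H>)
  case 0
  then show ?case by (intro exI[of _ \<H>]) auto
next
  case (Suc m)
  show ?case
  proof (cases "\<forall>v\<in>Y. card {e\<in>\<H>. v \<in> e} > d")
    case True
    then show ?thesis using Suc.prems by (intro exI[of _ \<H>]) auto
  next
    case False
    then obtain v where v: "v \<in> Y" "card {e\<in>\<H>. v \<in> e} \<le> d" by force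
    let ?H = "{e\<in>\<H>. v \<notin> e}"
    have "card \<H> = card {e\<in>\<H>. v \<in> e} + card ?H"
      using Suc.prems(2) by (subst card_Un_disjoint[symmetric]) (auto intro!: arg_cong[of _ _ card])
    moreover have cY: "card Y = Suc (card (Y - {v}))"
      using v Suc.prems(1) by (metis card_Suc_Diff1)
    ultimately have "card ?H > d * card (Y - {v})" using Suc.prems(3) v(2) by auto
    moreover have "m = card (Y - {v})" using cY Suc.hyps(2) by simp
    ultimately obtain \<H>' where "\<H>' \<subseteq> ?H" "\<H>' \<noteq> {}"
      "\<forall>w\<in>(Y - {v}) \<inter> \<Union>\<H>'. card {e\<in>\<H>'. w \<in> e} > d"
      using Suc.hyps(1)[of "Y - {v}" ?H] Suc.prems by auto
    then show ?thesis by (intro exI[of _ \<H>']) auto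
  qed
qed

text \<open>A vertex set without a 2-core can be dismantled by removing vertices of degree at most one;
  in the reverse order each new vertex is placed in a fresh fibre of \<open>\<beta>\<close>, joined to the image of
  its only earlier neighbour.\<close>

lemma forest_embedding:
  fixes E :: "'a set set" and \<beta> :: "'b \<Rightarrow> 'c"
  assumes "finite X" "acyclic_on E X" "finite E" "\<And>e. e \<in> E \<Longrightarrow> card e = 2" "U \<noteq> {}"
    and fresh: "\<And>y Used J. y \<in> U \<Longrightarrow> finite Used \<Longrightarrow> card Used \<le> card E \<Longrightarrow> finite J \<Longrightarrow>
          card J \<le> N \<Longrightarrow> \<exists>h\<in>\<H> - Used. y \<in> h \<and> (\<exists>w\<in>h \<inter> U. \<beta> w \<notin> J)"
    and "card X \<le> N"
  shows "\<exists>f \<phi>. f ` X \<subseteq> U \<and> inj_on (\<beta> \<circ> f) X \<and> inj_on \<phi> {e\<in>E. e \<subseteq> X} \<and>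
           (\<forall>e\<in>E. e \<subseteq> X \<longrightarrow> \<phi> e \<in> \<H> \<and> f ` e \<subseteq> \<phi> e)"
  using assms(1,2,7)
proof (induction "card X" arbitrary: X)
  case 0
  have "{} \<notin> E" using assms(4) by fastforce
  moreover have "X = {}" using 0 by simp
  ultimately have "{e\<in>E. e \<subseteq> X} = {}" by auto
  then show ?case using \<open>X = {}\<close> by (intro exI[of _ "\<lambda>_. undefined"]) (auto simp: inj_on_def)
next
  case (Suc m)
  have "X \<noteq> {}" using Suc.hyps(2) by auto
  then have "\<not> two_core E X" using Suc.prems(2) by (simp add: acyclic_on_def)
  with \<open>X \<noteq> {}\<close> obtain x where x: "x \<in> X" and
    one: "\<And>y z. y \<in> X \<Longrightarrow> z \<in> X \<Longrightarrow> {x, y} \<in> E \<Longrightarrow> {x, z} \<in> E \<Longrightarrow> y = z"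
    unfolding two_core_def by metis
  let ?X = "X - {x}"
  have "m = card ?X" using Suc.hyps(2) x Suc.prems(1) by simp
  moreover have "acyclic_on E ?X" using Suc.prems(2) by (rule acyclic_on_subset) auto
  ultimately obtain f \<phi> where f: "f ` ?X \<subseteq> U" "inj_on (\<beta> \<circ> f) ?X"
    and \<phi>: "inj_on \<phi> {e\<in>E. e \<subseteq> ?X}" "\<forall>e\<in>E. e \<subseteq> ?X \<longrightarrow> \<phi> e \<in> \<H> \<and> f ` e \<subseteq> \<phi> e"
    using Suc.hyps(1)[of ?X] Suc.prems Suc.hyps(2) by auto
  \<comment> \<open>The hyperedge for \<open>x\<close> has to pass through the image of its only
    neighbour in \<open>?X\<close>; without a neighbour any vertex of \<open>U\<close> will
    do.\<close>
  obtain y\<^sub>0 where y\<^sub>0: "y\<^sub>0 \<in> U" "\<And>y. y \<in> ?X \<Longrightarrow> {x, y} \<in> E \<Longrightarrow> y\<^sub>0 = f y"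
  proof (cases "\<exists>y\<in>?X. {x, y} \<in> E")
    case True
    then obtain y where "y \<in> ?X" "{x, y} \<in> E" by blast
    then show ?thesis using that[of "f y"] f(1) one by blast
  next
    case False
    then show ?thesis using that assms(5) by blast
  qed
  have "card (\<phi> ` {e\<in>E. e \<subseteq> ?X}) \<le> card E"
    using assms(3) by (intro card_image_le[THEN order_trans] card_mono) auto
  moreover have "card ((\<beta> \<circ> f) ` ?X) \<le> N"
    using card_image_le[of ?X "\<beta> \<circ> f"] Suc.prems(1,3) card_mono[of X ?X] by auto
  ultimately obtain h w where h: "h \<in> \<H>" "h \<notin> \<phi> ` {e\<in>E. e \<subseteq> ?X}" "y\<^sub>0 \<in> h"
    and w: "w \<in> h" "w \<in> U" "\<beta> w \<notin> (\<beta> \<circ> f) ` ?X"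
    using fresh[OF y\<^sub>0(1), of "\<phi> ` {e\<in>E. e \<subseteq> ?X}" "(\<beta> \<circ> f) ` ?X"] assms(3) Suc.prems(1)
    by auto
  let ?f = "f(x := w)"
  let ?\<phi> = "\<lambda>e. if x \<in> e then h else \<phi> e"
  have ex: "\<exists>y. e = {x, y} \<and> y \<in> ?X" if "e \<in> E" "e \<subseteq> X" "x \<in> e" for e
    using assms(4)[OF that(1)] that(2,3) unfolding card_2_iff by blast
  have uniq: "e = e'" if "e \<in> E" "e \<subseteq> X" "x \<in> e" "e' \<in> E" "e' \<subseteq> X" "x \<in> e'" for e e'
    using ex[OF that(1-3)] ex[OF that(4-6)] one that by (metis DiffD1)
  have 1: "?f ` X \<subseteq> U" using f(1) w(2) by auto
  have "inj_on (\<beta> \<circ> ?f) (insert x ?X)"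
  proof (subst inj_on_insert, intro conjI)
    show "inj_on (\<beta> \<circ> ?f) ?X" using f(2) by (auto simp: inj_on_def)
    have "(\<beta> \<circ> ?f) ` (?X - {x}) = (\<beta> \<circ> f) ` ?X" by (intro image_cong) auto
    then show "(\<beta> \<circ> ?f) x \<notin> (\<beta> \<circ> ?f) ` (?X - {x})" using w(3) by simp
  qed
  moreover have "insert x ?X = X" using x by blast
  ultimately have 2: "inj_on (\<beta> \<circ> ?f) X" by simp
  have 3: "inj_on ?\<phi> {e\<in>E. e \<subseteq> X}"
  proof (rule inj_onI)
    fix e e' assume e: "e \<in> {e\<in>E. e \<subseteq> X}" "e' \<in> {e\<in>E. e \<subseteq> X}" "?\<phi> e = ?\<phi> e'"
    have sub: "d \<in> {e\<in>E. e \<subseteq> ?X}" if "d \<in> {e\<in>E. e \<subseteq> X}" "x \<notin> d" for d using that by blast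
    have neq: "h \<noteq> \<phi> d" if "d \<in> {e\<in>E. e \<subseteq> X}" "x \<notin> d" for d
      using h(2) sub[OF that] by auto
    show "e = e'"
    proof (cases "x \<in> e"; cases "x \<in> e'")
      assume "x \<in> e" "x \<in> e'" then show ?thesis using uniq e by blast
    next
      assume "x \<in> e" "x \<notin> e'" then show ?thesis using e neq[of e'] by simp
    next
      assume "x \<notin> e" "x \<in> e'" then show ?thesis using e neq[of e] by simp
    next
      assume "x \<notin> e" "x \<notin> e'"
      then show ?thesis using inj_onD[OF \<phi>(1), of e e'] e sub by auto
    qed
  qed
  have 4: "?\<phi> e \<in> \<H> \<and> ?f ` e \<subseteq> ?\<phi> e" if e: "e \<in> E" "e \<subseteq> X" for e
  proof (cases "x \<in> e")
    case True
    then obtain y where y: "e = {x, y}" "y \<in> ?X" using ex e by blast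
    then have "y\<^sub>0 = f y" using y\<^sub>0(2) e(1) by simp
    then show ?thesis using y h w by auto
  next
    case False
    then have "e \<subseteq> ?X" using e by blast
    then have "\<phi> e \<in> \<H> \<and> f ` e \<subseteq> \<phi> e" using \<phi>(2) e by blast
    moreover have "?f ` e = f ` e" using False by (intro image_cong) auto
    ultimately show ?thesis using False by simp
  qed
  show ?case
    by (rule exI[of _ ?f], rule exI[of _ ?\<phi>]) (use 1 2 3 4 in blast)
qed

section \<open>Embedding into dense supergraphs of the skeleton\<close>

definition block :: "nat \<Rightarrow> nat \<Rightarrow> nat \<Rightarrow> nat set" where
  "block z b t = {z + t * b..<z + t * b + b}"

text \<open>Intended layout: the core \<open>{..<u}\<close>, room for boundedly many extra
  hyperedges up to \<open>z\<close>, then blocks of length \<open>b\<close>. As \<open>D c\<close>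
  will contain \<open>c\<close>, the hyperedge \<open>block z b t \<union> D c\<close> can realize
  an edge between \<open>c\<close> and any one vertex of block \<open>t\<close>.\<close>

definition main_edges :: "nat \<Rightarrow> nat \<Rightarrow> (nat \<Rightarrow> nat set) \<Rightarrow> nat \<Rightarrow> nat \<Rightarrow> nat set set" where
  "main_edges z b D u n = {block z b t \<union> D c | t c. t < (n - z) div b \<and> c < u}"

lemma in_block_iff:
  assumes "0 < b"
  shows "v \<in> block z b t \<longleftrightarrow> z \<le> v \<and> (v - z) div b = t"
  using assms div_less_iff_less_mult[of b "v - z" "Suc t"] less_eq_div_iff_mult_less_eq[of b t "v - z"]
  by (auto simp: block_def intro!: antisym)

lemma card_block [simp]: "card (block z b t) = b" by (simp add: block_def)

lemma finite_block [simp]: "finite (block z b t)" by (simp add: block_def)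

text \<open>\<open>D c\<close> lies below \<open>z\<close> and the block does not, so both parts can
  be read off from the union. Hyperedges chosen for distinct pairs are therefore distinct.\<close>

lemma main_edge_eqD:
  assumes "0 < b" "u \<le> z" "\<And>c. c < u \<Longrightarrow> D c \<subseteq> {..<u}" "inj_on D {..<u}"
    and "c < u" "c' < u" "block z b t \<union> D c = block z b t' \<union> D c'"
  shows "t = t' \<and> c = c'"
proof -
  have D: "D c \<subseteq> {..<z}" "D c' \<subseteq> {..<z}"
    using assms(2,3,5,6) by (meson dual_order.trans lessThan_subset_iff)+
  have B: "block z b s \<inter> {..<z} = {}" for s by (auto simp: block_def)
  have "D c = D c'" using assms(7) D B[of t] B[of t'] by blast
  moreover have "block z b t = block z b t'" using assms(7) D B[of t] B[of t'] by blast
  moreover have "z + t * b \<in> block z b t" using assms(1) by (simp add: block_def)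
  ultimately show ?thesis
    using assms(1,4,5,6) in_block_iff[OF assms(1)] by (metis inj_onD lessThan_iff)
qed

lemma block_subset:
  assumes "t < (n - z) div b" shows "block z b t \<subseteq> {..<n}"
proof -
  have "Suc t * b \<le> (n - z) div b * b" using assms by (intro mult_right_mono) auto
  also have "\<dots> \<le> n - z" by simp
  finally have "t * b + b \<le> n - z" by simp
  moreover have "z \<le> n" using assms by (cases "z \<le> n") auto
  ultimately show ?thesis by (auto simp: block_def)
qed

lemma card_main_edges_le: "finite (main_edges z b D u n)" "card (main_edges z b D u n) \<le> u * n"
proof -
  have eq: "main_edges z b D u n = (\<lambda>(t, c). block z b t \<union> D c) ` ({..<(n - z) div b} \<times> {..<u})"
    by (auto simp: main_edges_def)
  show "finite (main_edges z b D u n)" unfolding eq by simp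
  have "card (main_edges z b D u n) \<le> card ({..<(n - z) div b} \<times> {..<u})"
    unfolding eq by (intro card_image_le) simp
  also have "\<dots> \<le> n * u"
    using order_trans[OF div_le_dividend[of "n - z" b] diff_le_self]
    by (simp add: card_cartesian_product)
  finally show "card (main_edges z b D u n) \<le> u * n" by (simp add: mult.commute)
qed

text \<open>\<open>A\<close> goes below \<open>z\<close> with its inner edges realized in
  \<open>X\<close>, the forest \<open>F - A\<close> goes greedily into the surplus hyperedges, and
  mixed edges use the main edges. In \<open>d\<close>, the first summand bounds the hyperedges
  already used, the second those lying inside used blocks and the vertices outside all
  blocks.\<close>

lemma dense_supergraph_embedding:
  fixes F :: "'a hypergraph" and z b :: nat
  defines "d \<equiv> card (hedges F) + 2 ^ (z + b + card (verts F) * b)"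
  assumes F: "graph F" and b: "0 < b" and u: "u \<le> z" and n: "z \<le> n"
    and D: "\<And>c. c < u \<Longrightarrow> c \<in> D c \<and> D c \<subseteq> {..<u}" "inj_on D {..<u}"
    and X: "X \<subseteq> Pow {..<z}"
    and H: "main_edges z b D u n \<union> X \<subseteq> H" "H \<subseteq> Pow {..<n}"
    and big: "card H > u * n + 2 ^ z + 2 ^ (z + b) + d * n"
    and A: "A \<subseteq> verts F" "acyclic_on (hedges F) (verts F - A)"
    and f\<^sub>0: "inj_on f\<^sub>0 A" "f\<^sub>0 ` A \<subseteq> {..<z}"
    and \<phi>\<^sub>0: "inj_on \<phi>\<^sub>0 {e\<in>hedges F. e \<subseteq> A}"
      "\<And>e. e \<in> hedges F \<Longrightarrow> e \<subseteq> A \<Longrightarrow> \<phi>\<^sub>0 e \<in> X \<and> f\<^sub>0 ` e \<subseteq> \<phi>\<^sub>0 e"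
    and cross: "\<And>e a. e \<in> hedges F \<Longrightarrow> \<not> e \<subseteq> A \<Longrightarrow> a \<in> e \<Longrightarrow> a \<in> A \<Longrightarrow> f\<^sub>0 a < u"
  shows "\<exists>f \<phi>. berge_emb F f \<phi> ({..<n}, H)"
proof -
  let ?V = "verts F" and ?E = "hedges F" and ?M = "main_edges z b D u n"
  define J where "J = (n - z) div b"
  \<comment> \<open>\<open>Z\<close> collects the vertices in no block: the front part and a
    remainder of fewer than \<open>b\<close> vertices at the end. A hyperedge inside
    \<open>Z\<close> offers no place for a forest vertex, so \<open>Hs\<close> omits it.\<close>
  define Z where "Z = {..<z} \<union> {z + J * b..<n}"
  define Hs where "Hs = H - ?M - X - Pow Z"
  let ?Y = "{..<n} - Z"
  define \<beta> where "\<beta> = (\<lambda>v. (v - z) div b)"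
  have Jb: "J * b + (n - z) mod b = n - z" unfolding J_def by simp
  have "(n - z) mod b < b" using b by simp
  with Jb have "card {z + J * b..<n} \<le> b" by simp
  then have cZ: "card Z \<le> z + b" unfolding Z_def
    by (intro order_trans[OF card_Un_le]) simp
  have fZ: "finite Z" unfolding Z_def by simp
  have finH: "finite H" using H(2) finite_subset by blast
  have Y: "v \<in> block z b (\<beta> v) \<and> \<beta> v < J \<and> z \<le> v" if "v \<in> ?Y" for v
  proof -
    have v: "z \<le> v" "v < z + J * b" using that by (auto simp: Z_def)
    then have "\<beta> v < J" unfolding \<beta>_def using b by (simp add: div_less_iff_less_mult)
    then show ?thesis using v(1) in_block_iff[OF b] by (auto simp: \<beta>_def)
  qed
  have cX: "card X \<le> 2 ^ z" using X card_mono[of "Pow {..<z}" X] by (simp add: card_Pow)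
  have cPZ: "card (Pow Z) \<le> 2 ^ (z + b)" using cZ fZ by (simp add: card_Pow)
  \<comment> \<open>Discarding \<open>?M\<close>, \<open>X\<close> and \<open>Pow Z\<close> costs at
    most the first three summands of \<open>big\<close>, so more than \<open>d * n\<close>
    hyperedges remain.\<close>
  have "card H \<le> card (Hs \<union> (?M \<union> X \<union> Pow Z))"
    using finH fZ card_main_edges_le(1) X
    by (intro card_mono) (auto simp: Hs_def intro: finite_subset[of X "Pow {..<z}"])
  also have "\<dots> \<le> card Hs + (card ?M + card X + card (Pow Z))"
    by (meson add_left_mono add_right_mono card_Un_le order_trans)
  also have "\<dots> \<le> card Hs + (u * n + 2 ^ z + 2 ^ (z + b))"
    using card_main_edges_le(2) cX cPZ by (intro add_mono) auto
  finally have "card Hs > d * n" using big by simp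
  moreover have "card ?Y \<le> n" using card_mono[of "{..<n}" ?Y] by simp
  ultimately have "card Hs > d * card ?Y" by (meson le_trans mult_le_mono2 not_le)
  moreover have "finite Hs" using finH by (simp add: Hs_def)
  ultimately obtain H' where H': "H' \<subseteq> Hs" "H' \<noteq> {}"
    "\<forall>v\<in>?Y \<inter> \<Union>H'. card {e\<in>H'. v \<in> e} > d"
    using large_min_degree_subfamily[of ?Y Hs d] by auto
  have finH': "finite H'" using H'(1) \<open>finite Hs\<close> by (rule finite_subset)
  have H'n: "h \<subseteq> {..<n}" if "h \<in> H'" for h using that H'(1) H(2) by (auto simp: Hs_def)
  define U where "U = \<Union>H' - Z"
  have UY: "U \<subseteq> ?Y" using H'n by (auto simp: U_def)
  obtain h\<^sub>0 where h0: "h\<^sub>0 \<in> H'" using H'(2) by auto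
  then have "\<not> h\<^sub>0 \<subseteq> Z" using H'(1) by (auto simp: Hs_def)
  with h0 have Une: "U \<noteq> {}" by (auto simp: U_def)
  have fresh: "\<exists>h\<in>H' - Used. y \<in> h \<and> (\<exists>w\<in>h \<inter> U. \<beta> w \<notin> K)"
    if y: "y \<in> U" and us: "finite Used" "card Used \<le> card ?E"
      and K: "finite K" "card K \<le> card ?V" for y Used K
  proof -
    \<comment> \<open>The new vertex must avoid \<open>?B\<close>. More than \<open>d\<close>
      hyperedges pass through \<open>y\<close>, too many for all of them to be used or contained in
      \<open>?B\<close>.\<close>
    let ?B = "Z \<union> (\<Union>j\<in>K. block z b j)"
    have "card (\<Union>j\<in>K. block z b j) \<le> (\<Sum>j\<in>K. card (block z b j))"
      by (rule card_UN_le[OF K(1)])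
    also have "\<dots> \<le> card ?V * b" using K(2) by simp
    finally have "card ?B \<le> z + b + card ?V * b"
      using cZ by (meson add_mono card_Un_le le_trans)
    moreover have finB: "finite ?B" using fZ K(1) by simp
    ultimately have "card (Pow ?B) \<le> 2 ^ (z + b + card ?V * b)"
      by (simp only: card_Pow) (rule power_increasing, simp_all)
    then have "card (Used \<union> Pow ?B) \<le> d"
      unfolding d_def using us(2) by (meson add_mono card_Un_le le_trans)
    also have "d < card {e\<in>H'. y \<in> e}" using H'(3) y UY by (auto simp: U_def)
    finally have "\<not> {e\<in>H'. y \<in> e} \<subseteq> Used \<union> Pow ?B"
      using card_mono[of "Used \<union> Pow ?B" "{e\<in>H'. y \<in> e}"] us(1) finB by auto
    then obtain h where h: "h \<in> H'" "y \<in> h" "h \<notin> Used" "\<not> h \<subseteq> ?B" by auto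
    then obtain w where w: "w \<in> h" "w \<notin> ?B" by auto
    then have "w \<in> U" using h(1) by (auto simp: U_def)
    moreover have "\<beta> w \<notin> K" using Y[of w] \<open>w \<in> U\<close> UY w(2) by auto
    ultimately show ?thesis using h w by auto
  qed
  have E2: "card e = 2" if "e \<in> ?E" for e using F that by (simp add: graph_def uniform_def)
  have "card (?V - A) \<le> card ?V" using graph_finite[OF F] by (intro card_mono) auto
  then obtain f\<^sub>1 \<phi>\<^sub>1 where f\<^sub>1: "f\<^sub>1 ` (?V - A) \<subseteq> U" "inj_on (\<beta> \<circ> f\<^sub>1) (?V - A)"
    and \<phi>\<^sub>1: "inj_on \<phi>\<^sub>1 {e\<in>?E. e \<subseteq> ?V - A}"
      "\<forall>e\<in>?E. e \<subseteq> ?V - A \<longrightarrow> \<phi>\<^sub>1 e \<in> H' \<and> f\<^sub>1 ` e \<subseteq> \<phi>\<^sub>1 e"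
    using forest_embedding[of "?V - A" ?E U "card ?V" H' \<beta>, OF _ A(2) _ E2 Une fresh]
      graph_finite[OF F] by auto
  define f where "f = (\<lambda>v. if v \<in> A then f\<^sub>0 v else f\<^sub>1 v)"
  define g where "g = (\<lambda>x a. block z b (\<beta> (f\<^sub>1 x)) \<union> D (f\<^sub>0 a))"
  \<comment> \<open>Choosing \<phi> through a relation avoids having to recover from a mixed edge
    which end lies in \<open>A\<close>.\<close>
  define P where "P = (\<lambda>e h. (e \<subseteq> A \<and> h = \<phi>\<^sub>0 e) \<or> (e \<subseteq> ?V - A \<and> h = \<phi>\<^sub>1 e) \<or>
    (\<exists>a\<in>A. \<exists>x\<in>?V - A. e = {a, x} \<and> h = g x a))"
  have f1U: "f\<^sub>1 x \<in> ?Y" if "x \<in> ?V - A" for x using f\<^sub>1(1) UY that by auto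
  have gM: "g x a \<in> ?M" if "x \<in> ?V - A" "f\<^sub>0 a < u" for x a
    using Y[OF f1U[OF that(1)]] that(2) by (auto simp: g_def main_edges_def J_def)
  have "\<exists>h. P e h" if e: "e \<in> ?E" for e
  proof -
    obtain x y where "e = {x, y}" "x \<in> ?V" "y \<in> ?V" by (rule graph_edge[OF F e])
    then show ?thesis unfolding P_def by (cases "x \<in> A"; cases "y \<in> A") (auto simp: insert_commute)
  qed
  then obtain \<phi> where P: "\<And>e. e \<in> ?E \<Longrightarrow> P e (\<phi> e)" by metis
  have f0u: "f\<^sub>0 a < u" if "{a, x} \<in> ?E" "a \<in> A" "x \<in> ?V - A" for a x
    using cross[OF that(1), of a] that by auto
  have kind: "(e \<subseteq> A \<and> \<phi> e = \<phi>\<^sub>0 e \<and> \<phi> e \<in> X) \<or>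
      (e \<subseteq> ?V - A \<and> \<phi> e = \<phi>\<^sub>1 e \<and> \<phi> e \<in> H') \<or>
      (\<exists>a\<in>A. \<exists>x\<in>?V - A. e = {a, x} \<and> \<phi> e = g x a \<and> f\<^sub>0 a < u \<and> \<phi> e \<in> ?M)" if "e \<in> ?E" for e
    using P[OF that] unfolding P_def
  proof (elim disjE bexE conjE)
    fix a x assume "a \<in> A" "x \<in> ?V - A" "e = {a, x}" "\<phi> e = g x a"
    moreover from this have "f\<^sub>0 a < u" using f0u that by simp
    ultimately show ?thesis using gM by auto
  qed (use \<phi>\<^sub>0(2)[OF that] \<phi>\<^sub>1(2) that in auto)
  \<comment> \<open>\<open>?M\<close>, \<open>X\<close> and \<open>H'\<close> are pairwise disjoint,
    so injectivity of \<phi> can be checked separately for each of the three kinds of edges.\<close>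
  have MX: "?M \<inter> X = {}"
  proof -
    have False if "t < J" "c < u" "block z b t \<union> D c \<in> X" for t c
    proof -
      have "z + t * b \<in> block z b t" using b by (simp add: block_def)
      then show False using that(3) X by auto
    qed
    then show ?thesis by (auto simp: main_edges_def J_def)
  qed
  have H'd: "H' \<inter> ?M = {}" "H' \<inter> X = {}" using H'(1) by (auto simp: Hs_def)
  have Dsub: "D c \<subseteq> {..<u}" if "c < u" for c using D(1)[OF that] by simp
  have kX: "e \<subseteq> A \<and> \<phi> e = \<phi>\<^sub>0 e" if "e \<in> ?E" "\<phi> e \<in> X" for e
    using kind[OF that(1)] that(2) MX H'd by auto
  have kH: "e \<subseteq> ?V - A \<and> \<phi> e = \<phi>\<^sub>1 e" if "e \<in> ?E" "\<phi> e \<in> H'" for e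
    using kind[OF that(1)] that(2) MX H'd by auto
  have kM: "\<exists>a\<in>A. \<exists>x\<in>?V - A. e = {a, x} \<and> \<phi> e = g x a \<and> f\<^sub>0 a < u"
    if "e \<in> ?E" "\<phi> e \<in> ?M" for e
    using kind[OF that(1)] that(2) MX H'd by auto
  have "inj_on \<phi> ?E"
  proof (rule inj_onI)
    fix e e' assume e: "e \<in> ?E" "e' \<in> ?E" "\<phi> e = \<phi> e'"
    consider "\<phi> e \<in> X" | "\<phi> e \<in> H'" | "\<phi> e \<in> ?M" using kind[OF e(1)] by auto
    then show "e = e'"
    proof cases
      case 1
      then show ?thesis
        using kX[OF e(1)] kX[OF e(2)] inj_onD[OF \<phi>\<^sub>0(1), of e e'] e by simp
    next
      case 2
      then show ?thesis
        using kH[OF e(1)] kH[OF e(2)] inj_onD[OF \<phi>\<^sub>1(1), of e e'] e by simp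
    next
      case 3
      obtain a x where ax: "a \<in> A" "x \<in> ?V - A" "e = {a, x}" "\<phi> e = g x a" "f\<^sub>0 a < u"
        using kM[OF e(1) 3] by auto
      obtain a' x' where ax': "a' \<in> A" "x' \<in> ?V - A" "e' = {a', x'}" "\<phi> e' = g x' a'" "f\<^sub>0 a' < u"
        using kM[OF e(2)] 3 e(3) by auto
      have "g x a = g x' a'" using ax(4) ax'(4) e(3) by simp
      then have "\<beta> (f\<^sub>1 x) = \<beta> (f\<^sub>1 x') \<and> f\<^sub>0 a = f\<^sub>0 a'"
        unfolding g_def using main_edge_eqD[OF b u Dsub D(2) ax(5) ax'(5)] by simp
      then have "x = x' \<and> a = a'"
        using ax ax' inj_onD[OF f\<^sub>1(2), of x x'] inj_onD[OF f\<^sub>0(1), of a a'] by auto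
      then show ?thesis using ax ax' by simp
    qed
  qed
  moreover have "\<phi> ` ?E \<subseteq> H"
  proof -
    have "H' \<subseteq> H" using H'(1) by (auto simp: Hs_def)
    then show ?thesis using kind H(1) by blast
  qed
  moreover have "f ` e \<subseteq> \<phi> e" if e: "e \<in> ?E" for e
    using P[OF e] unfolding P_def
  proof (elim disjE bexE conjE)
    assume "e \<subseteq> A" "\<phi> e = \<phi>\<^sub>0 e"
    moreover from this have "f ` e = f\<^sub>0 ` e" by (intro image_cong) (auto simp: f_def)
    ultimately show ?thesis using \<phi>\<^sub>0(2)[OF e] by simp
  next
    assume "e \<subseteq> ?V - A" "\<phi> e = \<phi>\<^sub>1 e"
    moreover from this have "f ` e = f\<^sub>1 ` e" by (intro image_cong) (auto simp: f_def)
    ultimately show ?thesis using \<phi>\<^sub>1(2) e by simp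
  next
    fix a x assume ax: "a \<in> A" "x \<in> ?V - A" "e = {a, x}" "\<phi> e = g x a"
    then have "f\<^sub>0 a < u" using f0u e by simp
    then show ?thesis using ax Y[OF f1U[OF ax(2)]] D(1) by (auto simp: f_def g_def)
  qed
  moreover have "f ` ?V \<subseteq> {..<n}" using f\<^sub>0(2) n f1U by (fastforce simp: f_def)
  moreover have "inj_on f ?V"
  proof (rule inj_onI)
    fix v w assume vw: "v \<in> ?V" "w \<in> ?V" "f v = f w"
    have lo: "f x < z" if "x \<in> A" for x using that f\<^sub>0(2) by (auto simp: f_def)
    have hi: "z \<le> f x" if "x \<in> ?V - A" for x using that Y[OF f1U[OF that]] by (simp add: f_def)
    consider "v \<in> A" "w \<in> A" | "v \<in> ?V - A" "w \<in> ?V - A"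
      using lo[of v] hi[of w] lo[of w] hi[of v] vw by (metis DiffI not_le)
    then show "v = w"
    proof cases
      case 1
      then show ?thesis using inj_onD[OF f\<^sub>0(1), of v w] vw by (simp add: f_def)
    next
      case 2
      then show ?thesis using inj_onD[OF f\<^sub>1(2), of v w] vw by (simp add: f_def)
    qed
  qed
  ultimately show ?thesis by (intro exI[of _ f] exI[of _ \<phi>]) (simp add: berge_emb_def)
qed

text \<open>A saturated family containing the skeleton has at most \<open>K * n\<close> hyperedges,
  since otherwise \<open>dense_supergraph_embedding\<close> finds a copy in it. The condition
  \<open>free\<close> makes such a family exist.\<close>

lemma sat_linear_of_free:
  fixes F :: "'a hypergraph"
  assumes F: "graph F" and b: "0 < b" and u: "u \<le> z"
    and D: "\<And>c. c < u \<Longrightarrow> c \<in> D c \<and> D c \<subseteq> {..<u} \<and> card (D c) + b = k" "inj_on D {..<u}"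
    and X: "\<And>e. e \<in> X \<Longrightarrow> e \<subseteq> {..<z} \<and> card e = k"
    and free: "\<And>n f \<phi>. z \<le> n \<Longrightarrow> \<not> berge_emb F f \<phi> ({..<n}, main_edges z b D u n \<union> X)"
    and A: "A \<subseteq> verts F" "acyclic_on (hedges F) (verts F - A)"
    and f\<^sub>0: "inj_on f\<^sub>0 A" "f\<^sub>0 ` A \<subseteq> {..<z}"
    and \<phi>\<^sub>0: "inj_on \<phi>\<^sub>0 {e\<in>hedges F. e \<subseteq> A}"
      "\<And>e. e \<in> hedges F \<Longrightarrow> e \<subseteq> A \<Longrightarrow> \<phi>\<^sub>0 e \<in> X \<and> f\<^sub>0 ` e \<subseteq> \<phi>\<^sub>0 e"
    and cross: "\<And>e a. e \<in> hedges F \<Longrightarrow> \<not> e \<subseteq> A \<Longrightarrow> a \<in> e \<Longrightarrow> a \<in> A \<Longrightarrow> f\<^sub>0 a < u"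
  shows "(\<lambda>n. real (berge_sat k n F)) \<in> O[sequentially](\<lambda>n. real n)"
proof -
  define d where "d = card (hedges F) + 2 ^ (z + b + card (verts F) * b)"
  define K where "K = u + 2 ^ z + 2 ^ (z + b) + d"
  have le: "berge_sat k n F \<le> K * n" if n: "z < n" for n
  proof -
    let ?H0 = "main_edges z b D u n \<union> X"
    have H0: "e \<subseteq> {..<n} \<and> card e = k" if "e \<in> ?H0" for e
      using that
    proof
      assume "e \<in> X"
      then show ?thesis using X[of e] n by auto
    next
      assume "e \<in> main_edges z b D u n"
      then obtain t c where tc: "e = block z b t \<union> D c" "t < (n - z) div b" "c < u"
        by (auto simp: main_edges_def)
      then have Dc: "D c \<subseteq> {..<u}" "card (D c) + b = k" using D(1) by auto
      then have "block z b t \<inter> D c = {}" using u by (fastforce simp: block_def)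
      then have "card e = k" unfolding tc(1)
        using Dc by (subst card_Un_disjoint) (auto intro: finite_subset)
      then show ?thesis using tc block_subset[OF tc(2)] Dc(1) u n by auto
    qed
    have "hypergraph ({..<n}, ?H0)" using H0 by (auto simp: hypergraph_def)
    then have "\<not> contains_berge F ({..<n}, ?H0)"
      using free n by (simp add: contains_berge_iff)
    then obtain H where H: "?H0 \<subseteq> H" "berge_saturated k F ({..<n}, H)"
      using saturated_extends[of "{..<n}" ?H0 k F] H0 by auto
    then have hH: "hypergraph ({..<n}, H)" by (simp add: berge_saturated_def)
    then have "\<not> (\<exists>f \<phi>. berge_emb F f \<phi> ({..<n}, H))"
      using H(2) contains_berge_iff[OF hH, of F] by (simp add: berge_saturated_def)
    moreover have "H \<subseteq> Pow {..<n}" using hH by (auto simp: hypergraph_def)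
    ultimately have "\<not> card H > u * n + 2 ^ z + 2 ^ (z + b) + d * n"
      using dense_supergraph_embedding[OF F b u _ _ D(2) _ H(1) _ _ A f\<^sub>0 \<phi>\<^sub>0 cross] D(1) X n
      unfolding d_def by (auto simp: subset_iff)
    then have "card H \<le> u * n + 2 ^ z + 2 ^ (z + b) + d * n" by simp
    \<comment> \<open>The strict inequality \<open>z < n\<close> gives n \<ge> 1, which absorbs the
      constant summands.\<close>
    also have "\<dots> \<le> u * n + 2 ^ z * n + 2 ^ (z + b) * n + d * n"
      using n by (intro add_mono) auto
    also have "\<dots> = K * n" by (simp add: K_def algebra_simps)
    finally have "card H \<le> K * n" .
    moreover have "berge_sat k n F \<le> card H"
      unfolding berge_sat_def
      by (intro cInf_lower CollectI exI[of _ "({..<n}, H)"]) (use H(2) in auto)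
    ultimately show ?thesis by simp
  qed
  show ?thesis
  proof (rule bigoI[of _ "real K"], rule eventually_sequentiallyI[of "Suc z"])
    fix n assume "Suc z \<le> n"
    then have "real (berge_sat k n F) \<le> real (K * n)" using le[of n] by (intro of_nat_mono) simp
    then show "norm (real (berge_sat k n F)) \<le> real K * norm (real n)" by simp
  qed
qed

section \<open>Berge copies inside the skeleton\<close>

lemma berge_embD:
  assumes "berge_emb F f \<phi> (W, \<H>)"
  shows "inj_on f (verts F)" "inj_on \<phi> (hedges F)"
    "\<And>e. e \<in> hedges F \<Longrightarrow> \<phi> e \<in> \<H>" "\<And>e x. e \<in> hedges F \<Longrightarrow> x \<in> e \<Longrightarrow> f x \<in> \<phi> e"
  using assms by (fastforce simp: berge_emb_def)+

lemma two_coreD: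
  assumes "two_core E S" "x \<in> S"
  obtains y y' where "y \<in> S" "y' \<in> S" "y \<noteq> y'" "{x, y} \<in> E" "{x, y'} \<in> E"
  using assms unfolding two_core_def by blast

lemma two_core_subset_verts:
  assumes "graph F" "two_core (hedges F) S"
  shows "S \<subseteq> verts F"
proof
  fix x assume "x \<in> S"
  then obtain y where "{x, y} \<in> hedges F" using assms(2) by (metis two_coreD)
  then show "x \<in> verts F" using assms(1) by (auto simp: graph_def hypergraph_def)
qed

text \<open>\<open>P\<close> is a region such as a block, \<open>Q\<close> contains all hyperedges
  entering it, and \<open>C\<close> is the core. Two neighbours of \<open>x\<close> cannot both be
  mapped to \<open>c\<close>, so \<open>S\<close> continues inside \<open>P\<close> and spends three
  hyperedges of \<open>Q\<close> there. A region with only two such hyperedges is thus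
  excluded.\<close>

lemma two_core_cluster:
  assumes F: "graph F" and emb: "berge_emb F f \<phi> (W, \<H>)" and S: "two_core (hedges F) S"
    and core: "\<And>v. v \<in> S \<Longrightarrow> f v \<in> C \<Longrightarrow> f v = c"
    and P: "\<And>h. h \<in> \<H> \<Longrightarrow> h \<inter> P \<noteq> {} \<Longrightarrow> h \<in> Q" "\<And>h. h \<in> Q \<Longrightarrow> h \<subseteq> P \<union> C"
    and x: "x \<in> S" "f x \<in> P"
  shows two_core_neighbour:
      "\<And>y. y \<in> S \<Longrightarrow> {x, y} \<in> hedges F \<Longrightarrow> \<phi> {x, y} \<in> Q \<and> (f y \<in> P \<or> f y = c)"
    and two_core_neighbour_in: "\<exists>y\<in>S. f y \<in> P \<and> {x, y} \<in> hedges F"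
    and two_core_three_edges: "3 \<le> card {e \<in> hedges F. e \<subseteq> S \<and> \<phi> e \<in> Q}"
proof -
  note e = berge_embD[OF emb]
  have nb: "\<phi> {v, y} \<in> Q \<and> (f y \<in> P \<or> f y = c)"
    if "v \<in> S" "f v \<in> P" "y \<in> S" "{v, y} \<in> hedges F" for v y
  proof -
    have "f v \<in> \<phi> {v, y}" "f y \<in> \<phi> {v, y}" using e(4)[OF that(4)] by auto
    moreover from this have "\<phi> {v, y} \<in> Q" using P(1) e(3)[OF that(4)] that(2) by auto
    ultimately show ?thesis using P(2) core[OF that(3)] by blast
  qed
  show "\<And>y. y \<in> S \<Longrightarrow> {x, y} \<in> hedges F \<Longrightarrow> \<phi> {x, y} \<in> Q \<and> (f y \<in> P \<or> f y = c)"
    using nb x by simp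
  have SV: "S \<subseteq> verts F" by (rule two_core_subset_verts[OF F S])
  obtain y\<^sub>1 y\<^sub>2 where y12: "y\<^sub>1 \<in> S" "y\<^sub>2 \<in> S" "y\<^sub>1 \<noteq> y\<^sub>2" "{x, y\<^sub>1} \<in> hedges F" "{x, y\<^sub>2} \<in> hedges F"
    using two_coreD[OF S x(1)] by metis
  have "y\<^sub>1 \<in> verts F" "y\<^sub>2 \<in> verts F" using y12 SV by auto
  then have "\<not> (f y\<^sub>1 = c \<and> f y\<^sub>2 = c)" using y12(3) inj_onD[OF e(1), of y\<^sub>1 y\<^sub>2] by auto
  then have "f y\<^sub>1 \<in> P \<or> f y\<^sub>2 \<in> P" using nb[OF x] y12 by metis
  then obtain y y' where y: "y \<in> S" "y' \<in> S" "y \<noteq> y'" "{x, y} \<in> hedges F" "{x, y'} \<in> hedges F" "f y \<in> P"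
    using y12 by metis
  then show "\<exists>y\<in>S. f y \<in> P \<and> {x, y} \<in> hedges F" by auto
  \<comment> \<open>The third edge: \<open>y\<close> is again mapped into \<open>P\<close> and has a
    neighbour other than \<open>x\<close>.\<close>
  obtain w where w: "w \<in> S" "w \<noteq> x" "{y, w} \<in> hedges F" using two_coreD[OF S y(1)] by metis
  have xy: "x \<noteq> y" "x \<noteq> y'" using graph_no_loop[OF F] y by auto
  let ?T = "{e \<in> hedges F. e \<subseteq> S \<and> \<phi> e \<in> Q}"
  have "{{x, y}, {x, y'}, {y, w}} \<subseteq> ?T" using nb x y w by auto
  moreover have "finite ?T" using graph_finite(2)[OF F] by simp
  moreover have "distinct [{x, y}, {x, y'}, {y, w}]"
    using xy w(2) y(3) by (simp add: doubleton_eq_iff)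
  from distinct_card[OF this] have "card {{x, y}, {x, y'}, {y, w}} = 3" by simp
  ultimately show "3 \<le> card ?T" using card_mono[of ?T "{{x, y}, {x, y'}, {y, w}}"] by simp
qed

text \<open>An edge of \<open>S\<close> with both ends mapped into \<open>C\<close> would have both
  ends mapped to \<open>c\<close>.\<close>

lemma two_core_outside:
  assumes F: "graph F" and emb: "berge_emb F f \<phi> (W, \<H>)" and S: "two_core (hedges F) S"
    and core: "\<And>v. v \<in> S \<Longrightarrow> f v \<in> C \<Longrightarrow> f v = c"
  shows "\<exists>x\<in>S. f x \<notin> C"
proof -
  obtain x where x: "x \<in> S" using S by (auto simp: two_core_def)
  obtain y where y: "y \<in> S" "{x, y} \<in> hedges F" using two_coreD[OF S x] by metis
  have "x \<noteq> y" using graph_no_loop[OF F y(2)] .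
  then have "f x \<noteq> f y"
    using inj_onD[OF berge_embD(1)[OF emb], of x y] two_core_subset_verts[OF F S] x y by auto
  then show ?thesis using core x y by metis
qed

section \<open>The hyperedges at a block\<close>

definition block_edges :: "nat \<Rightarrow> nat \<Rightarrow> (nat \<Rightarrow> nat set) \<Rightarrow> nat \<Rightarrow> nat \<Rightarrow> nat set set" where
  "block_edges z b D u t = (\<lambda>c. block z b t \<union> D c) ` {..<u}"

lemma card_block_edges: "finite (block_edges z b D u t)" "card (block_edges z b D u t) \<le> u"
  using card_image_le[of "{..<u}" "\<lambda>c. block z b t \<union> D c"] by (simp_all add: block_edges_def)

lemma block_disjoint: "0 < b \<Longrightarrow> t \<noteq> t' \<Longrightarrow> block z b t \<inter> block z b t' = {}"
  by (auto simp: in_block_iff)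

definition skeleton ::
    "nat \<Rightarrow> nat \<Rightarrow> (nat \<Rightarrow> nat set) \<Rightarrow> nat \<Rightarrow> nat \<Rightarrow> nat set set \<Rightarrow> nat set set" where
  "skeleton z b D u n X = main_edges z b D u n \<union> X"

text \<open>Extra hyperedges stay below \<open>z\<close> and blocks are disjoint, so a block is
  connected to the rest only through the core.\<close>

lemma skeleton_block:
  assumes b: "0 < b" and u: "u \<le> z" and D: "\<And>c. c < u \<Longrightarrow> D c \<subseteq> {..<u}"
    and X: "\<And>e. e \<in> X \<Longrightarrow> e \<subseteq> {..<z}"
    and h: "h \<in> skeleton z b D u n X" "h \<inter> block z b t \<noteq> {}"
  shows "h \<in> block_edges z b D u t"
proof -
  obtain v where v: "v \<in> h" "v \<in> block z b t" using h(2) by auto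
  then have "z \<le> v" by (simp add: in_block_iff[OF b])
  then have "h \<notin> X" using X[of h] v(1) by fastforce
  then obtain s c where s: "h = block z b s \<union> D c" "c < u"
    using h(1) by (auto simp: skeleton_def main_edges_def)
  then have "v \<in> block z b s" using v(1) D[OF s(2)] \<open>z \<le> v\<close> u by auto
  then have "s = t" using v(2) by (simp add: in_block_iff[OF b])
  then show ?thesis using s by (simp add: block_edges_def)
qed

text \<open>A vertex lying in one hyperedge only has degree at most one in every Berge copy of a graph.\<close>

definition private_outside :: "nat \<Rightarrow> nat set set \<Rightarrow> bool" where
  "private_outside u X \<longleftrightarrow> (\<forall>e\<in>X. \<forall>e'\<in>X. \<forall>v\<in>e \<inter> e'. v < u \<or> e = e')"

definition triangle_component :: "'a hypergraph \<Rightarrow> 'a set \<Rightarrow> bool" where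
  "triangle_component F T \<longleftrightarrow> T \<subseteq> verts F \<and> card T = 3 \<and>
     (\<forall>x\<in>T. \<forall>y\<in>T. x \<noteq> y \<longrightarrow> {x, y} \<in> hedges F) \<and>
     (\<forall>e\<in>hedges F. e \<inter> T \<noteq> {} \<longrightarrow> e \<subseteq> T)"

text \<open>A hypothetical Berge copy of \<open>F\<close> in the skeleton, fixed for all the
  arguments that refute it.\<close>

locale skeleton_embedding =
  fixes F :: "'a hypergraph" and f :: "'a \<Rightarrow> nat" and \<phi> :: "'a set \<Rightarrow> nat set"
    and z b u n :: nat and D :: "nat \<Rightarrow> nat set" and X :: "nat set set"
  assumes F: "graph F" and b: "0 < b" and u: "u \<le> z"
    and D: "\<And>c. c < u \<Longrightarrow> D c \<subseteq> {..<u}"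
    and X: "\<And>e. e \<in> X \<Longrightarrow> e \<subseteq> {..<z}"
    and emb: "berge_emb F f \<phi> ({..<n}, skeleton z b D u n X)"
begin

lemmas embD = berge_embD[OF emb]

text \<open>Stands for a cycle inside core vertex \<open>c\<close> and block \<open>t\<close>.
  \<open>S\<close> may run through further blocks and may miss \<open>c\<close>; the arguments look
  at its edges at block \<open>t\<close>.\<close>

definition cluster :: "'a set \<Rightarrow> nat \<Rightarrow> nat \<Rightarrow> bool" where
  "cluster S c t \<longleftrightarrow> two_core (hedges F) S \<and> (\<forall>v\<in>S. f v < u \<longrightarrow> f v = c) \<and>
     (\<exists>x\<in>S. f x \<in> block z b t)"

lemma block_edges_subset: "h \<in> block_edges z b D u t \<Longrightarrow> h \<subseteq> block z b t \<union> {..<u}"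
  using D by (auto simp: block_edges_def)

lemma cluster_neighbour:
  assumes "cluster S c t" "x \<in> S" "f x \<in> block z b t"
  shows "y \<in> S \<Longrightarrow> {x, y} \<in> hedges F \<Longrightarrow>
      \<phi> {x, y} \<in> block_edges z b D u t \<and> (f y \<in> block z b t \<or> f y = c)"
    and "\<exists>y\<in>S. f y \<in> block z b t \<and> {x, y} \<in> hedges F"
proof -
  have S: "two_core (hedges F) S" "\<And>v. v \<in> S \<Longrightarrow> f v \<in> {..<u} \<Longrightarrow> f v = c"
    using assms(1) by (auto simp: cluster_def)
  note * = F emb S skeleton_block[OF b u D X] block_edges_subset assms(2,3)
  show "y \<in> S \<Longrightarrow> {x, y} \<in> hedges F \<Longrightarrow>
      \<phi> {x, y} \<in> block_edges z b D u t \<and> (f y \<in> block z b t \<or> f y = c)"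
    by (rule two_core_neighbour[OF *])
  show "\<exists>y\<in>S. f y \<in> block z b t \<and> {x, y} \<in> hedges F"
    by (rule two_core_neighbour_in[OF *])
qed

lemma cluster_three_edges:
  assumes "cluster S c t"
  shows "3 \<le> card {e \<in> hedges F. e \<subseteq> S \<and> \<phi> e \<in> block_edges z b D u t}"
proof -
  have S: "two_core (hedges F) S" "\<And>v. v \<in> S \<Longrightarrow> f v \<in> {..<u} \<Longrightarrow> f v = c"
    using assms(1) by (auto simp: cluster_def)
  obtain x where "x \<in> S" "f x \<in> block z b t" using assms by (auto simp: cluster_def)
  from two_core_three_edges[OF F emb S skeleton_block[OF b u D X] block_edges_subset this]
  show ?thesis .
qed

lemma edges_in_block_le: "card {e \<in> hedges F. \<phi> e \<in> block_edges z b D u t} \<le> u"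
proof -
  have "inj_on \<phi> {e \<in> hedges F. \<phi> e \<in> block_edges z b D u t}"
    using embD(2) by (rule inj_on_subset) auto
  then have "card {e \<in> hedges F. \<phi> e \<in> block_edges z b D u t} \<le> card (block_edges z b D u t)"
    by (rule card_inj_on_le) (auto simp: card_block_edges)
  then show ?thesis using card_block_edges(2) order_trans by blast
qed

text \<open>A vertex of \<open>S\<close> mapped off the core has two edges, hence two hyperedges
  through its image. By \<open>priv\<close> they are not both in \<open>X\<close>, so one is a main
  edge and the image lies in its block. Asking \<open>priv\<close> only along \<open>S\<close>
  covers the case of the extra triangle as well.\<close>

lemma cluster_exists:
  assumes S: "two_core (hedges F) S" "\<And>v. v \<in> S \<Longrightarrow> f v < u \<Longrightarrow> f v = c"
    and priv: "\<And>x e e'. x \<in> S \<Longrightarrow> e \<in> X \<Longrightarrow> e' \<in> X \<Longrightarrow> f x \<in> e \<Longrightarrow> f x \<in> e' \<Longrightarrow> f x < u \<or> e = e'"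
  shows "\<exists>t. cluster S c t"
proof -
  obtain x where x: "x \<in> S" "u \<le> f x"
    using two_core_outside[OF F emb S(1), of "{..<u}" c] S(2) by auto
  obtain y y' where y: "y \<in> S" "y' \<in> S" "y \<noteq> y'" "{x, y} \<in> hedges F" "{x, y'} \<in> hedges F"
    using two_coreD[OF S(1) x(1)] by metis
  have ne: "\<phi> {x, y} \<noteq> \<phi> {x, y'}"
    using inj_onD[OF embD(2), of "{x, y}" "{x, y'}"] y by (auto simp: doubleton_eq_iff)
  have fx: "f x \<in> \<phi> {x, y}" "f x \<in> \<phi> {x, y'}" using embD(4) y by auto
  then have "\<not> (\<phi> {x, y} \<in> X \<and> \<phi> {x, y'} \<in> X)" using priv[OF x(1)] ne x(2) by auto
  then obtain h where h: "h \<in> main_edges z b D u n" "f x \<in> h"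
    using embD(3) y fx unfolding skeleton_def by blast
  then obtain t c' where "h = block z b t \<union> D c'" "c' < u" by (auto simp: main_edges_def)
  then have "f x \<in> block z b t" using h(2) D[of c'] x(2) by auto
  then show ?thesis using S x by (auto simp: cluster_def)
qed

text \<open>Fewer than \<open>u\<close> vertices are mapped to core vertices other than
  \<open>c\<close>, so by \<open>fv\<close> a 2-core survives their deletion.\<close>

lemma cluster_avoiding:
  assumes c: "c < u" and priv: "private_outside u X"
    and fv: "\<And>A. A \<subseteq> verts F \<Longrightarrow> acyclic_on (hedges F) (verts F - A) \<Longrightarrow> u \<le> card A"
  shows "\<exists>S t. cluster S c t"
proof -
  let ?A = "{v \<in> verts F. f v < u \<and> f v \<noteq> c}"
  have "inj_on f ?A" using embD(1) by (rule inj_on_subset) auto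
  then have "card ?A \<le> card ({..<u} - {c})" by (rule card_inj_on_le) auto
  then have "card ?A < u" using c by simp
  then have "\<not> acyclic_on (hedges F) (verts F - ?A)" using fv[of ?A] by auto
  then obtain S where S: "S \<subseteq> verts F - ?A" "two_core (hedges F) S"
    by (auto simp: acyclic_on_def)
  have "\<exists>t. cluster S c t"
  proof (rule cluster_exists[OF S(2)])
    show "f v = c" if "v \<in> S" "f v < u" for v using that S(1) by auto
    show "f x < u \<or> e = e'" if "e \<in> X" "e' \<in> X" "f x \<in> e" "f x \<in> e'" for x e e'
      using priv that unfolding private_outside_def by auto
  qed
  then show ?thesis by auto
qed

text \<open>A cluster needs three hyperedges of one block, which has at most \<open>u\<close> of
  them.\<close>

lemma no_embedding_core_le_two:
  assumes "0 < u" "u \<le> 2" "private_outside u X"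
    and "\<And>A. A \<subseteq> verts F \<Longrightarrow> acyclic_on (hedges F) (verts F - A) \<Longrightarrow> u \<le> card A"
  shows False
proof -
  obtain S t where S: "cluster S 0 t" using cluster_avoiding[of 0] assms by blast
  let ?T = "{e \<in> hedges F. \<phi> e \<in> block_edges z b D u t}"
  have "card {e \<in> hedges F. e \<subseteq> S \<and> \<phi> e \<in> block_edges z b D u t} \<le> card ?T"
    using graph_finite(2)[OF F] by (intro card_mono) auto
  then show False using cluster_three_edges[OF S] edges_in_block_le[of t] assms(2) by simp
qed

text \<open>In the application \<open>G\<close> is a Berge triangle away from the core. Deleting the
  vertex mapped to 1 and one end of an edge realized in \<open>G\<close> removes at most two
  vertices, so a 2-core \<open>S\<close> survives. Using \<open>G\<close> off the core would take
  three edges of \<open>S\<close> realized in \<open>G\<close>, but one of at most three is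
  destroyed. So \<open>S\<close> is a cluster, in a block with only two hyperedges.\<close>

lemma no_embedding_gadget:
  assumes "u = 2" and X': "X = X' \<union> G" "finite G" "card G \<le> 3"
    and priv: "\<And>e e' v. e \<in> X' \<Longrightarrow> e' \<in> X \<Longrightarrow> v \<in> e \<Longrightarrow> v \<in> e' \<Longrightarrow> v < u \<or> e = e'"
    and fv: "\<And>A. A \<subseteq> verts F \<Longrightarrow> acyclic_on (hedges F) (verts F - A) \<Longrightarrow> 3 \<le> card A"
  shows False
proof -
  let ?G = "{e \<in> hedges F. \<phi> e \<in> G}"
  have finG: "finite ?G" using graph_finite(2)[OF F] by simp
  have "inj_on \<phi> ?G" using embD(2) by (rule inj_on_subset) auto
  then have "card ?G \<le> card G" by (rule card_inj_on_le) (auto simp: X'(2))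
  then have cG: "card ?G \<le> 3" using X'(3) by simp
  obtain A\<^sub>1 where A1: "A\<^sub>1 \<subseteq> verts F" "card A\<^sub>1 \<le> 1" "?G \<noteq> {} \<Longrightarrow> \<exists>e\<in>?G. e \<inter> A\<^sub>1 \<noteq> {}"
  proof (cases "?G = {}")
    case True
    then show ?thesis using that[of "{}"] by auto
  next
    case False
    then obtain e where "e \<in> ?G" by blast
    moreover from this obtain p where "p \<in> e" "p \<in> verts F" using graph_edge[OF F, of e] by auto
    ultimately show ?thesis using that[of "{p}"] by auto
  qed
  let ?A = "{v \<in> verts F. f v = 1} \<union> A\<^sub>1"
  have "inj_on f {v \<in> verts F. f v = 1}" using embD(1) by (rule inj_on_subset) auto
  then have "card {v \<in> verts F. f v = 1} \<le> card {1::nat}" by (rule card_inj_on_le) auto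
  then have "card ?A < 3" using A1(2) card_Un_le[of "{v \<in> verts F. f v = 1}" A\<^sub>1] by simp
  then have "\<not> acyclic_on (hedges F) (verts F - ?A)" using fv[of ?A] A1(1) by fastforce
  then obtain S where S: "S \<subseteq> verts F - ?A" "two_core (hedges F) S"
    by (auto simp: acyclic_on_def)
  have core: "f v = 0" if "v \<in> S" "f v < u" for v using that S(1) assms(1) by (cases "f v = 0") auto
  have noG: "f x < u" if x: "x \<in> S" and g: "g \<in> G" "f x \<in> g" for x g
  proof (rule ccontr)
    assume "\<not> f x < u"
    then have fx: "f x \<in> \<Union>G - {..<u}" using g by auto
    \<comment> \<open>Off the core, \<open>G\<close> lies between \<open>u\<close> and
      \<open>z\<close>, where no main edge has a vertex; \<open>priv\<close> excludes the other
      extra hyperedges.\<close>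
    have hG: "h \<in> G" if h: "h \<in> skeleton z b D u n X" "h \<inter> (\<Union>G - {..<u}) \<noteq> {}" for h
    proof -
      obtain v where "v \<in> h \<inter> (\<Union>G - {..<u})" using h(2) by blast
      then obtain g where v: "v \<in> h" "v \<in> g" "g \<in> G" "u \<le> v" by auto
      then have "v < z" using X[of g] X'(1) by auto
      then have "h \<notin> main_edges z b D u n"
        using v(1,4) D by (fastforce simp: main_edges_def block_def)
      then have "h \<in> X" using h(1) by (auto simp: skeleton_def)
      then show ?thesis using priv[of h g v] v X'(1) by auto
    qed
    have core': "f v = 0" if "v \<in> S" "f v \<in> {..<u}" for v using core that by simp
    have sub: "h \<subseteq> (\<Union>G - {..<u}) \<union> {..<u}" if "h \<in> G" for h using that by auto
    have "3 \<le> card {e \<in> hedges F. e \<subseteq> S \<and> \<phi> e \<in> G}"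
      by (rule two_core_three_edges[OF F emb S(2) core' hG sub x(1) fx])
    moreover have "{e \<in> hedges F. e \<subseteq> S \<and> \<phi> e \<in> G} \<subset> ?G"
    proof -
      have "card {e \<in> hedges F. e \<subseteq> S \<and> \<phi> e \<in> G} \<le> card ?G" using finG by (intro card_mono) auto
      then have "3 \<le> card ?G" using \<open>3 \<le> card {e \<in> hedges F. e \<subseteq> S \<and> \<phi> e \<in> G}\<close> by linarith
      then have "?G \<noteq> {}" by (intro notI) simp
      then obtain e where "e \<in> ?G" "e \<inter> A\<^sub>1 \<noteq> {}" using A1(3) by blast
      moreover from this have "\<not> e \<subseteq> S" using S(1) by auto
      ultimately show ?thesis by auto
    qed
    from psubset_card_mono[OF finG this]
    have "card {e \<in> hedges F. e \<subseteq> S \<and> \<phi> e \<in> G} < card ?G" .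
    ultimately show False using cG by linarith
  qed
  have "\<exists>t. cluster S 0 t"
  proof (rule cluster_exists[OF S(2) core])
    fix x e e' assume "x \<in> S" "e \<in> X" "e' \<in> X" "f x \<in> e" "f x \<in> e'"
    then show "f x < u \<or> e = e'"
      using noG[of x e] priv[of e e' "f x"] X'(1) by auto
  qed auto
  then obtain t where t: "cluster S 0 t" by blast
  have "card {e \<in> hedges F. e \<subseteq> S \<and> \<phi> e \<in> block_edges z b D u t}
      \<le> card {e \<in> hedges F. \<phi> e \<in> block_edges z b D u t}"
    using graph_finite(2)[OF F] by (intro card_mono) auto
  then show False using cluster_three_edges[OF t] edges_in_block_le[of t] assms(1) by simp
qed

text \<open>Suppose the cover meets this set at most in \<open>w\<close>. Two adjacent vertices of
  \<open>S\<close> are mapped into the block, so one of them, \<open>s\<close>, differs from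
  \<open>w\<close>. All neighbours of \<open>s\<close> in \<open>S\<close> lie in the set, hence
  equal \<open>w\<close>, but there are two of them.\<close>

lemma cluster_cover_two:
  assumes S: "cluster S c t" and W: "vertex_cover (hedges F) W" "finite W"
  shows "2 \<le> card (W \<inter> ({v \<in> S. f v \<in> block z b t} \<union> {v \<in> verts F. f v = c}))"
    (is "2 \<le> card (W \<inter> ?Y)")
proof (rule ccontr)
  assume "\<not> ?thesis"
  then have "card (W \<inter> ?Y) \<le> Suc 0" by simp
  then obtain w where w: "W \<inter> ?Y \<subseteq> {w}"
    using W(2) card_le_Suc0_iff_eq[of "W \<inter> ?Y"] by blast
  have S2: "two_core (hedges F) S" using S by (simp add: cluster_def)
  obtain x where x: "x \<in> S" "f x \<in> block z b t" using S by (auto simp: cluster_def)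
  obtain y where y: "y \<in> S" "f y \<in> block z b t" "{x, y} \<in> hedges F"
    using cluster_neighbour(2)[OF S x] by blast
  obtain s where s: "s \<in> S" "f s \<in> block z b t" "s \<noteq> w"
    using x y graph_no_loop[OF F y(3)] by metis
  have "p = w" if p: "p \<in> S" "{s, p} \<in> hedges F" for p
  proof -
    have "{s, p} \<inter> W \<noteq> {}" using W(1) p(2) unfolding vertex_cover_def by (rule bspec)
    moreover have "p \<in> ?Y"
      using cluster_neighbour(1)[OF S s(1,2) p] p two_core_subset_verts[OF F S2] by auto
    ultimately show ?thesis using w s by auto
  qed
  then show False using two_coreD[OF S2 s(1)] by metis
qed

text \<open>Clusters of distinct core vertices sit in distinct blocks, so every vertex cover has two
  vertices in each of three disjoint sets.\<close>

lemma no_embedding_disjoint_clusters: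
  assumes "3 \<le> u" "private_outside u X"
    and fv: "\<And>A. A \<subseteq> verts F \<Longrightarrow> acyclic_on (hedges F) (verts F - A) \<Longrightarrow> u \<le> card A"
    and W: "vertex_cover (hedges F) W" "finite W" "card W < 6"
    and disj: "\<And>S S' c c' t. c < u \<Longrightarrow> c' < u \<Longrightarrow> cluster S c t \<Longrightarrow> cluster S' c' t \<Longrightarrow> c = c'"
  shows False
proof -
  have "\<forall>c\<in>{..<u}. \<exists>S t. cluster S c t" using cluster_avoiding[OF _ assms(2) fv] by auto
  then obtain S t where St: "\<And>c. c < u \<Longrightarrow> cluster (S c) c (t c)" by (metis lessThan_iff)
  define Y where "Y = (\<lambda>c. {v \<in> S c. f v \<in> block z b (t c)} \<union> {v \<in> verts F. f v = c})"
  have "(W \<inter> Y c) \<inter> (W \<inter> Y c') = {}" if c: "c < u" "c' < u" "c \<noteq> c'" for c c'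
  proof -
    have "t c \<noteq> t c'" using disj[OF c(1,2)] St c by metis
    then have "block z b (t c) \<inter> block z b (t c') = {}" using block_disjoint[OF b] by simp
    moreover have "c \<notin> block z b s" "c' \<notin> block z b s" for s using c u by (auto simp: block_def)
    ultimately show ?thesis using c(3) by (auto simp: Y_def)
  qed
  \<comment> \<open>Three clusters suffice for every u \<ge> 3, as they already force six vertices
    of \<open>W\<close>.\<close>
  then have "card (\<Union>c\<in>{..<3}. W \<inter> Y c) = (\<Sum>c\<in>{..<3::nat}. card (W \<inter> Y c))"
    using assms(1) W(2) by (intro card_UN_disjoint) auto
  moreover have "(\<Sum>c\<in>{..<3::nat}. card (W \<inter> Y c)) \<ge> (\<Sum>c\<in>{..<3::nat}. 2)"
    using cluster_cover_two[OF St W(1,2)] assms(1) unfolding Y_def by (intro sum_mono) auto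
  moreover have "card (\<Union>c\<in>{..<3}. W \<inter> Y c) \<le> card W" using W(2) by (intro card_mono) auto
  ultimately show False using W(3) by simp
qed

section \<open>Two clusters in one block\<close>

lemma in_block_card_le: "card {v \<in> verts F. f v \<in> block z b t} \<le> b"
proof -
  have "inj_on f {v \<in> verts F. f v \<in> block z b t}" using embD(1) by (rule inj_on_subset) auto
  then have "card {v \<in> verts F. f v \<in> block z b t} \<le> card (block z b t)"
    by (rule card_inj_on_le) auto
  then show ?thesis by simp
qed

text \<open>With blocks of size two, a cluster is a triangle \<open>x y a\<close> with \<open>f a = c\<close>; two of them in one
  block would need five of its hyperedges.\<close>

lemma clusters_disjoint_pairs:
  assumes b2: "b = 2" and "u \<le> 4" and c: "c < u" "c' < u"
    and S: "cluster S c t" "cluster S' c' t"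
  shows "c = c'"
proof (rule ccontr)
  assume ne: "c \<noteq> c'"
  obtain x where x: "x \<in> S" "f x \<in> block z b t" using S(1) by (auto simp: cluster_def)
  obtain y where y: "y \<in> S" "f y \<in> block z b t" "{x, y} \<in> hedges F"
    using cluster_neighbour(2)[OF S(1) x] by blast
  have xy: "x \<noteq> y" using graph_no_loop[OF F y(3)] .
  have SV: "R \<subseteq> verts F" if "cluster R d t" for R d
    using that two_core_subset_verts[OF F] by (auto simp: cluster_def)
  let ?B = "{v \<in> verts F. f v \<in> block z b t}"
  have "{x, y} \<subseteq> ?B" using x y SV[OF S(1)] by auto
  moreover have "card ?B \<le> card {x, y}" using in_block_card_le[of t] b2 xy by simp
  moreover have "finite ?B" using graph_finite(1)[OF F] by simp
  ultimately have B: "?B = {x, y}" using card_seteq[of ?B "{x, y}"] by simp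
  \<comment> \<open>Only \<open>x\<close> and \<open>y\<close> are mapped to block \<open>t\<close>,
    so every cluster there contains both, and each of them needs a second neighbour, which is mapped
    to the core vertex of the cluster.\<close>
  have hub: "\<exists>a\<in>verts F. f a = d \<and> {x, a} \<in> hedges F \<and> {y, a} \<in> hedges F \<and> {x, y} \<in> hedges F \<and>
      \<phi> {x, a} \<in> block_edges z b D u t \<and> \<phi> {y, a} \<in> block_edges z b D u t \<and>
      \<phi> {x, y} \<in> block_edges z b D u t"
    if R: "cluster R d t" for R d
  proof -
    have R2: "two_core (hedges F) R" using R by (simp add: cluster_def)
    have RB: "v = x \<or> v = y" if "v \<in> R" "f v \<in> block z b t" for v using that B SV[OF R] by auto
    have hub1: "\<exists>a\<in>R. f a = d \<and> {v, a} \<in> hedges F \<and> \<phi> {v, a} \<in> block_edges z b D u t"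
      if v: "v \<in> R" "f v \<in> block z b t" for v
    proof -
      obtain p q where pq: "p \<in> R" "q \<in> R" "p \<noteq> q" "{v, p} \<in> hedges F" "{v, q} \<in> hedges F"
        using two_coreD[OF R2 v(1)] by metis
      have "p \<noteq> v" "q \<noteq> v" using graph_no_loop[OF F] pq by auto
      then have "\<not> (f p \<in> block z b t \<and> f q \<in> block z b t)" using RB pq RB[OF v] by metis
      then show ?thesis using cluster_neighbour(1)[OF R v] pq by metis
    qed
    obtain v where v: "v \<in> R" "f v \<in> block z b t" using R by (auto simp: cluster_def)
    obtain w where w: "w \<in> R" "f w \<in> block z b t" "{v, w} \<in> hedges F"
      using cluster_neighbour(2)[OF R v] by blast
    have vw: "v \<noteq> w" using graph_no_loop[OF F w(3)] .
    then have xyR: "x \<in> R" "y \<in> R" "{x, y} \<in> hedges F"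
      using RB[OF v] RB[OF w(1,2)] v w by (auto simp: insert_commute)
    obtain a where a: "a \<in> R" "f a = d" "{x, a} \<in> hedges F" "\<phi> {x, a} \<in> block_edges z b D u t"
      using hub1[OF xyR(1) x(2)] by blast
    obtain a' where a': "a' \<in> R" "f a' = d" "{y, a'} \<in> hedges F" "\<phi> {y, a'} \<in> block_edges z b D u t"
      using hub1[OF xyR(2) y(2)] by blast
    have "a = a'" using inj_onD[OF embD(1), of a a'] a a' SV[OF R] by auto
    then show ?thesis
      using a a' SV[OF R] xyR(3) cluster_neighbour(1)[OF R xyR(1) x(2) xyR(2,3)] by auto
  qed
  obtain a where a: "f a = c" "{x, a} \<in> hedges F" "{y, a} \<in> hedges F"
      "\<phi> {x, a} \<in> block_edges z b D u t" "\<phi> {y, a} \<in> block_edges z b D u t"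
      "\<phi> {x, y} \<in> block_edges z b D u t"
    using hub[OF S(1)] by blast
  obtain a' where a': "f a' = c'" "{x, a'} \<in> hedges F" "{y, a'} \<in> hedges F"
      "\<phi> {x, a'} \<in> block_edges z b D u t" "\<phi> {y, a'} \<in> block_edges z b D u t"
    using hub[OF S(2)] by blast
  let ?T = "{e \<in> hedges F. \<phi> e \<in> block_edges z b D u t}"
  let ?L = "{{x, y}, {x, a}, {y, a}, {x, a'}, {y, a'}}"
  have "z \<le> f x" "z \<le> f y" using x y by (auto simp: in_block_iff[OF b])
  then have d: "x \<noteq> a" "x \<noteq> a'" "y \<noteq> a" "y \<noteq> a'" "a \<noteq> a'" using a(1) a'(1) c u ne by auto
  have "distinct [{x, y}, {x, a}, {y, a}, {x, a'}, {y, a'}]"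
    using xy d d[symmetric] by (simp add: doubleton_eq_iff)
  from distinct_card[OF this] have "card ?L = 5" by simp
  moreover have "?L \<subseteq> ?T" using a a' y(3) by auto
  moreover have "finite ?T" using graph_finite(2)[OF F] by simp
  ultimately have "5 \<le> card ?T" using card_mono[of ?T ?L] by simp
  then show False using edges_in_block_le[of t] assms(2) by simp
qed

text \<open>Both clusters use all three hyperedges of the block, so none of these three edges of \<open>F\<close>
  reaches the core and they form a triangle component.\<close>

lemma clusters_disjoint_triples:
  assumes b3: "b = 3" and u3: "u = 3" and c: "c < u" "c' < u"
    and S: "cluster S c t" "cluster S' c' t"
    and no_triangle: "\<nexists>T. triangle_component F T"
  shows "c = c'"
proof (rule ccontr)
  assume ne: "c \<noteq> c'"
  let ?Q = "block_edges z b D u t"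
  let ?T = "{e \<in> hedges F. \<phi> e \<in> ?Q}"
  \<comment> \<open>Each cluster contains three edges of \<open>?T\<close>, and \<open>?T\<close>
    has at most three, so \<open>?T\<close> lies inside both clusters.\<close>
  have all: "e \<subseteq> R" if "cluster R d t" "e \<in> ?T" for R d e
  proof -
    have "{e \<in> hedges F. e \<subseteq> R \<and> \<phi> e \<in> ?Q} = ?T"
      using cluster_three_edges[OF that(1)] edges_in_block_le[of t] u3 graph_finite(2)[OF F]
      by (intro card_seteq) auto
    then show ?thesis using that(2) by blast
  qed
  \<comment> \<open>A vertex of both clusters that is mapped into the core would be mapped to
    \<open>c\<close> and to \<open>c'\<close>.\<close>
  have out: "u \<le> f v" if "e \<in> ?T" "v \<in> e" for e v
  proof (rule ccontr)
    assume "\<not> u \<le> f v"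
    moreover have "v \<in> S" "v \<in> S'" using all[OF S(1) that(1)] all[OF S(2) that(1)] that(2) by auto
    ultimately have "f v = c" "f v = c'" using S by (auto simp: cluster_def)
    then show False using ne by simp
  qed
  let ?B = "{v \<in> verts F. f v \<in> block z b t}"
  have hQ: "e \<in> ?T" if e: "e \<in> hedges F" "e \<inter> ?B \<noteq> {}" for e
  proof -
    obtain v where "v \<in> e" "f v \<in> block z b t" using e(2) by auto
    then have "\<phi> e \<inter> block z b t \<noteq> {}" using embD(4)[OF e(1)] by auto
    then show ?thesis using skeleton_block[OF b u D X embD(3)[OF e(1)]] e(1) by simp
  qed
  have eB: "e \<subseteq> ?B" if "e \<in> hedges F" "e \<inter> ?B \<noteq> {}" for e
  proof
    fix v assume v: "v \<in> e"
    have "f v \<in> block z b t"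
      using embD(4)[OF that(1) v] block_edges_subset[of "\<phi> e" t] hQ[OF that] out[OF hQ[OF that] v]
      by auto
    moreover have "v \<in> verts F" using v F that(1) by (auto simp: graph_def hypergraph_def)
    ultimately show "v \<in> ?B" by simp
  qed
  have SV: "S \<subseteq> verts F" using S(1) two_core_subset_verts[OF F] by (auto simp: cluster_def)
  have S2: "two_core (hedges F) S" using S(1) by (simp add: cluster_def)
  obtain x where x: "x \<in> S" "f x \<in> block z b t" using S(1) by (auto simp: cluster_def)
  have xB: "x \<in> ?B" using x SV by auto
  have nbs: "\<exists>p q. p \<in> ?B \<and> q \<in> ?B \<and> p \<noteq> q \<and> p \<noteq> v \<and> q \<noteq> v \<and>
      {v, p} \<in> hedges F \<and> {v, q} \<in> hedges F \<and> p \<in> S \<and> q \<in> S"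
    if v: "v \<in> ?B" "v \<in> S" for v
  proof -
    obtain p q where pq: "p \<in> S" "q \<in> S" "p \<noteq> q" "{v, p} \<in> hedges F" "{v, q} \<in> hedges F"
      using two_coreD[OF S2 v(2)] by metis
    moreover have "p \<in> ?B" "q \<in> ?B" using eB[OF pq(4)] eB[OF pq(5)] v(1) by auto
    moreover have "p \<noteq> v" "q \<noteq> v" using graph_no_loop[OF F] pq by auto
    ultimately show ?thesis by blast
  qed
  obtain p q where pq: "p \<in> ?B" "q \<in> ?B" "p \<noteq> q" "p \<noteq> x" "q \<noteq> x" "{x, p} \<in> hedges F"
      "{x, q} \<in> hedges F" "p \<in> S" "q \<in> S"
    using nbs[OF xB x(1)] by (elim exE conjE) (rule that)
  \<comment> \<open>\<open>x\<close> and two of its neighbours exhaust the block, so the two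
    neighbours of \<open>p\<close> can only be \<open>x\<close> and \<open>q\<close>.\<close>
  have "{x, p, q} \<subseteq> ?B" using xB pq by auto
  moreover have card3: "card {x, p, q} = 3" using pq by auto
  moreover have "card ?B \<le> 3" using in_block_card_le[of t] b3 by simp
  moreover have "finite ?B" using graph_finite(1)[OF F] by simp
  ultimately have B: "{x, p, q} = ?B" by (intro card_seteq) simp_all
  have "{p, q} \<in> hedges F"
  proof -
    obtain v w where "v \<in> {x, p, q}" "w \<in> {x, p, q}" "v \<noteq> w" "v \<noteq> p" "w \<noteq> p"
      "{p, v} \<in> hedges F" "{p, w} \<in> hedges F"
      using nbs[OF pq(1,8)] unfolding B[symmetric] by metis
    then show ?thesis by auto
  qed
  then have adj: "{v, w} \<in> hedges F" if "v \<in> {x, p, q}" "w \<in> {x, p, q}" "v \<noteq> w" for v w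
    using that pq by (auto simp: insert_commute)
  have "triangle_component F {x, p, q}"
    unfolding triangle_component_def
  proof (intro conjI ballI impI)
    show "e \<subseteq> {x, p, q}" if "e \<in> hedges F" "e \<inter> {x, p, q} \<noteq> {}" for e
      using eB that unfolding B by simp
    show "{x, p, q} \<subseteq> verts F" unfolding B by auto
  qed (use card3 adj in auto)
  then show False using no_triangle by blast
qed

text \<open>Each hyperedge has at most one vertex off the core, so each edge of \<open>F\<close> has
  an end mapped into the core. These ends would form a vertex cover of at most \<open>u\<close>
  vertices.\<close>

lemma no_embedding_single_outside:
  assumes b1: "b = 1" and X1: "\<And>e. e \<in> X \<Longrightarrow> card (e - {..<u}) \<le> 1"
    and cov: "\<And>W. W \<subseteq> verts F \<Longrightarrow> vertex_cover (hedges F) W \<Longrightarrow> u < card W"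
  shows False
proof -
  let ?W = "{v \<in> verts F. f v < u}"
  have "vertex_cover (hedges F) ?W"
    unfolding vertex_cover_def
  proof (intro ballI notI)
    fix e assume e: "e \<in> hedges F" "e \<inter> ?W = {}"
    obtain x y where xy: "e = {x, y}" "x \<noteq> y" "x \<in> verts F" "y \<in> verts F"
      by (rule graph_edge[OF F e(1)])
    have fxy: "f x \<in> \<phi> e - {..<u}" "f y \<in> \<phi> e - {..<u}" using embD(4)[OF e(1)] e(2) xy by auto
    have "finite (\<phi> e - {..<u}) \<and> card (\<phi> e - {..<u}) \<le> 1"
    proof (cases "\<phi> e \<in> X")
      case True
      then show ?thesis using X1 X[OF True] by (auto intro: finite_subset)
    next
      case False
      then obtain t c where "\<phi> e = block z b t \<union> D c" "c < u"
        using embD(3)[OF e(1)] by (auto simp: skeleton_def main_edges_def)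
      then have "\<phi> e - {..<u} \<subseteq> block z b t" using D by auto
      then show ?thesis using card_mono[OF finite_block] b1 finite_subset[OF _ finite_block]
        by (metis card_block)
    qed
    then have "f x = f y" using fxy card_le_Suc0_iff_eq[of "\<phi> e - {..<u}"] by auto
    then show False using inj_onD[OF embD(1), of x y] xy by auto
  qed
  then have "u < card ?W" using cov[of ?W] by auto
  moreover have "inj_on f ?W" using embD(1) by (rule inj_on_subset) auto
  then have "card ?W \<le> card {..<u}" by (rule card_inj_on_le) auto
  ultimately show False by simp
qed

end

section \<open>Choice of the skeleton\<close>

text \<open>For r > 1, start at u = r + 1 with \<open>D c\<close> omitting the cyclic successor of
  \<open>c\<close>; each further core vertex gets a set that is new because it contains this vertex.
  For r = u \<ge> 2 there would be only one set to choose.\<close>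

lemma core_sets_exist:
  assumes "1 \<le> r" "r = 1 \<or> r < u"
  shows "\<exists>D :: nat \<Rightarrow> nat set. inj_on D {..<u} \<and>
           (\<forall>c<u. c \<in> D c \<and> D c \<subseteq> {..<u} \<and> card (D c) = r)"
proof (cases "r = 1")
  case True
  then show ?thesis by (intro exI[of _ "\<lambda>c. {c}"]) (auto simp: inj_on_def)
next
  case False
  then have "Suc r \<le> u" using assms by simp
  then show ?thesis
  proof (induction u rule: dec_induct)
    case base
    define s where "s = (\<lambda>c. if c = r then 0 else Suc c)"
    have s: "s c < Suc r" "c \<noteq> s c" if "c < Suc r" for c
      using that assms(1) by (auto simp: s_def)
    have "inj_on (\<lambda>c. {..<Suc r} - {s c}) {..<Suc r}"
    proof (rule inj_onI)
      fix c c' assume c: "c \<in> {..<Suc r}" "c' \<in> {..<Suc r}" "{..<Suc r} - {s c} = {..<Suc r} - {s c'}"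
      then have "s c = s c'" using s(1)[of c] s(1)[of c'] by blast
      then show "c = c'" by (auto simp: s_def split: if_splits)
    qed
    then show ?case using s by (intro exI[of _ "\<lambda>c. {..<Suc r} - {s c}"]) auto
  next
    case (step u)
    then obtain D where D: "inj_on D {..<u}"
      "\<forall>c<u. c \<in> D c \<and> D c \<subseteq> {..<u} \<and> card (D c) = r" by blast
    let ?D = "D(u := insert u {..<r - 1})"
    have "inj_on ?D {..<Suc u}"
      unfolding lessThan_Suc
    proof (subst inj_on_insert, intro conjI)
      show "inj_on ?D {..<u}" using D(1) by (auto simp: inj_on_def)
      have "u \<in> ?D u" by simp
      moreover have "u \<notin> ?D c" if "c < u" for c using D(2) that by auto
      ultimately show "?D u \<notin> ?D ` ({..<u} - {u})" by (auto simp del: fun_upd_apply)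
    qed
    moreover have "c \<in> ?D c \<and> ?D c \<subseteq> {..<Suc u} \<and> card (?D c) = r" if "c < Suc u" for c
    proof (cases "c = u")
      case True
      then show ?thesis using assms(1) step.hyps by auto
    next
      case False
      then have "c < u" using that by simp
      then show ?thesis using D(2) by fastforce
    qed
    ultimately show ?case by blast
  qed
qed

text \<open>These hyperedges realize edges of \<open>F\<close> between two vertices of the core, which a block
  hyperedge need not contain together. With blocks of size one \<open>q = k - 1\<close> is needed, so that the
  core still covers every embedded edge.\<close>

definition pair_edges ::
    "nat \<Rightarrow> nat \<Rightarrow> nat \<Rightarrow> nat \<Rightarrow> nat set set \<Rightarrow> (nat set \<Rightarrow> nat set) \<Rightarrow> bool" where
  "pair_edges u q k z X ext \<longleftrightarrow> u \<le> z \<and>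
     (\<forall>e\<in>X. e \<subseteq> {..<z} \<and> card e = k \<and> card (e - {..<u}) = k - q) \<and>
     private_outside u X \<and> (u = 0 \<longrightarrow> X = {}) \<and>
     (\<forall>p. p \<subseteq> {..<u} \<longrightarrow> card p = 2 \<longrightarrow> ext p \<in> X \<and> p \<subseteq> ext p) \<and>
     inj_on ext {p. p \<subseteq> {..<u} \<and> card p = 2}"

lemma pair_edgesD:
  assumes "pair_edges u q k z X ext"
  shows "u \<le> z"
    "\<And>e. e \<in> X \<Longrightarrow> e \<subseteq> {..<z} \<and> card e = k \<and> card (e - {..<u}) = k - q"
    "private_outside u X" "u = 0 \<Longrightarrow> X = {}"
    "\<And>p. p \<subseteq> {..<u} \<Longrightarrow> card p = 2 \<Longrightarrow> ext p \<in> X \<and> p \<subseteq> ext p"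
    "inj_on ext {p. p \<subseteq> {..<u} \<and> card p = 2}"
  using assms unfolding pair_edges_def by auto

text \<open>Each pair is enlarged to a \<open>q\<close>-subset of the core and completed by its own
  \<open>k - q\<close> vertices from a slot of width \<open>k\<close> behind the core. As q < k, the
  new vertices exist and identify the pair.\<close>

lemma pair_edges_exist:
  fixes u q k :: nat
  assumes "2 \<le> u \<Longrightarrow> 2 \<le> q \<and> q \<le> u" "q < k"
  shows "\<exists>z X ext. pair_edges u q k z X ext"
proof -
  let ?P = "{p. p \<subseteq> {..<u} \<and> card p = 2}"
  have finP: "finite ?P" by (rule finite_subset[of _ "Pow {..<u}"]) auto
  then obtain idx where idx: "bij_betw idx ?P {0..<card ?P}"
    using ex_bij_betw_finite_nat by blast
  have "\<exists>R. p \<subseteq> R \<and> R \<subseteq> {..<u} \<and> card R = q" if "p \<in> ?P" for p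
  proof -
    have "2 \<le> u" using that card_mono[of "{..<u}" p] by auto
    then show ?thesis
      using exists_subset_between[of p q "{..<u}"] that assms(1) by auto
  qed
  then obtain R where R: "\<And>p. p \<in> ?P \<Longrightarrow> p \<subseteq> R p \<and> R p \<subseteq> {..<u} \<and> card (R p) = q" by metis
  define N where "N = (\<lambda>p. {u + idx p * k..<u + idx p * k + (k - q)})"
  define ext where "ext = (\<lambda>p. R p \<union> N p)"
  define z where "z = u + card ?P * k"
  have Nblock: "N p \<subseteq> block u k (idx p)" for p by (auto simp: N_def block_def)
  have Nu: "N p \<inter> {..<u} = {}" for p by (auto simp: N_def)
  have ext: "ext p \<subseteq> {..<z} \<and> card (ext p) = k \<and> card (ext p - {..<u}) = k - q" if p: "p \<in> ?P" for p
  proof -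
    have "idx p < card ?P" using bij_betwE[OF idx] p by auto
    then have "Suc (idx p) * k \<le> card ?P * k" by (intro mult_right_mono) auto
    then have "N p \<subseteq> {..<z}" by (auto simp: N_def z_def)
    moreover have "R p \<subseteq> {..<z}" using R[OF p] by (auto simp: z_def)
    moreover have "ext p - {..<u} = N p" using R[OF p] Nu[of p] by (auto simp: ext_def)
    moreover have "card (ext p) = card (R p) + card (N p)"
      unfolding ext_def using R[OF p] Nu[of p]
      by (intro card_Un_disjoint) (auto simp: N_def intro: finite_subset)
    moreover have "card (N p) = k - q" by (simp add: N_def)
    ultimately show ?thesis using R[OF p] assms(2) by (simp add: ext_def)
  qed
  have eq: "p = p'" if "p \<in> ?P" "p' \<in> ?P" "v \<in> ext p" "v \<in> ext p'" "u \<le> v" for p p' v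
  proof -
    have "v \<in> N p" "v \<in> N p'" using that R[of p] R[of p'] by (auto simp: ext_def)
    then have "v \<in> block u k (idx p)" "v \<in> block u k (idx p')" using Nblock by auto
    then have "idx p = idx p'" using in_block_iff[of k] assms(2) by auto
    then show ?thesis using inj_onD[OF bij_betw_imp_inj_on[OF idx], of p p'] that(1,2) by simp
  qed
  have inj: "inj_on ext ?P"
  proof (rule inj_onI)
    fix p p' assume p: "p \<in> ?P" "p' \<in> ?P" "ext p = ext p'"
    have "u + idx p * k \<in> ext p" using assms(2) by (auto simp: ext_def N_def)
    then show "p = p'" using eq[of p p' "u + idx p * k"] p by auto
  qed
  have priv: "private_outside u (ext ` ?P)"
    unfolding private_outside_def
  proof (intro ballI)
    fix e e' v assume "e \<in> ext ` ?P" "e' \<in> ext ` ?P" "v \<in> e \<inter> e'"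
    then obtain p p' where "e = ext p" "e' = ext p'" "p \<in> ?P" "p' \<in> ?P" "v \<in> ext p" "v \<in> ext p'"
      by blast
    then show "v < u \<or> e = e'" using eq[of p p' v] by auto
  qed
  have sub: "p \<subseteq> ext p" if "p \<in> ?P" for p using R[OF that] by (auto simp: ext_def)
  have "pair_edges u q k z (ext ` ?P) ext"
    unfolding pair_edges_def
  proof (intro conjI ballI allI impI)
    show "u \<le> z" by (simp add: z_def)
    show "private_outside u (ext ` ?P)" "inj_on ext ?P" by (fact priv, fact inj)
    show "ext ` ?P = {}" if "u = 0" using that by auto
  qed (use ext sub in auto)
  then show ?thesis by blast
qed

text \<open>Any injection of \<open>A\<close> into the core will do, since every pair of core
  vertices has its own hyperedge.\<close>

lemma core_embedding:
  assumes F: "graph F" and A: "A \<subseteq> verts F" "card A \<le> u"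
    and "pair_edges u q k z X ext"
  shows "\<exists>f\<^sub>0 \<phi>\<^sub>0. inj_on f\<^sub>0 A \<and> f\<^sub>0 ` A \<subseteq> {..<u} \<and> inj_on \<phi>\<^sub>0 {e\<in>hedges F. e \<subseteq> A} \<and>
    (\<forall>e. e \<in> hedges F \<longrightarrow> e \<subseteq> A \<longrightarrow> \<phi>\<^sub>0 e \<in> X \<and> f\<^sub>0 ` e \<subseteq> \<phi>\<^sub>0 e)"
proof -
  note ext = pair_edgesD(5,6)[OF assms(4)]
  have "finite A" using A(1) graph_finite(1)[OF F] by (rule finite_subset)
  then obtain f\<^sub>0 where f0: "f\<^sub>0 ` A \<subseteq> {..<u}" "inj_on f\<^sub>0 A"
    using card_le_inj[of A "{..<u}"] A(2) by auto
  have im: "f\<^sub>0 ` e \<subseteq> {..<u} \<and> card (f\<^sub>0 ` e) = 2" if "e \<in> hedges F" "e \<subseteq> A" for e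
  proof -
    have "card e = 2" using F that(1) by (simp add: graph_def uniform_def)
    moreover have "inj_on f\<^sub>0 e" using f0(2) that(2) by (rule inj_on_subset)
    ultimately show ?thesis using f0(1) that(2) by (auto simp: card_image)
  qed
  have "inj_on (\<lambda>e. ext (f\<^sub>0 ` e)) {e\<in>hedges F. e \<subseteq> A}"
  proof (rule inj_onI)
    fix e e' assume e: "e \<in> {e\<in>hedges F. e \<subseteq> A}" "e' \<in> {e\<in>hedges F. e \<subseteq> A}"
      "ext (f\<^sub>0 ` e) = ext (f\<^sub>0 ` e')"
    then have "f\<^sub>0 ` e = f\<^sub>0 ` e'" using inj_onD[OF ext(2) e(3)] im by auto
    then show "e = e'" using inj_on_image_eq_iff[OF f0(2)] e by auto
  qed
  then show ?thesis using f0 ext(1) im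
    by (intro exI[of _ f\<^sub>0] exI[of _ "\<lambda>e. ext (f\<^sub>0 ` e)"]) auto
qed

text \<open>\<open>r\<close> counts the core vertices of a main edge, so blocks have size
  \<open>k - r\<close>. With the hyperedges constructed here, each case only has to refute a copy
  inside the skeleton.\<close>

lemma sat_linear_of_no_embedding:
  fixes F :: "'a hypergraph"
  assumes F: "graph F" and r: "1 \<le> r" "r < k" "r = 1 \<or> r < u" and k: "3 \<le> k"
    and A: "A \<subseteq> verts F" "acyclic_on (hedges F) (verts F - A)" "card A \<le> u"
    and free: "\<And>f \<phi> z n D X. skeleton_embedding F f \<phi> z (k - r) u n D X \<Longrightarrow>
        private_outside u X \<Longrightarrow> (\<And>e. e \<in> X \<Longrightarrow> card (e - {..<u}) = k - max 2 r) \<Longrightarrow>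
        (u = 0 \<Longrightarrow> X = {}) \<Longrightarrow> False"
  shows "(\<lambda>n. real (berge_sat k n F)) \<in> O[sequentially](\<lambda>n. real n)"
proof -
  obtain D where D: "inj_on D {..<u}"
    "\<And>c. c < u \<Longrightarrow> c \<in> D c \<and> D c \<subseteq> {..<u} \<and> card (D c) = r"
    using core_sets_exist[OF r(1,3)] by blast
  \<comment> \<open>An extra hyperedge needs two core vertices to hold a pair; taking
    \<open>r\<close> of them if that is more leaves a single outside vertex when r = k - 1.\<close>
  have q: "2 \<le> u \<Longrightarrow> 2 \<le> max 2 r \<and> max 2 r \<le> u" "max 2 r < k" using r k by auto
  obtain z X ext where pe: "pair_edges u (max 2 r) k z X ext" using pair_edges_exist[OF q] by blast
  note X = pair_edgesD[OF pe]
  obtain f\<^sub>0 \<phi>\<^sub>0 where f0: "inj_on f\<^sub>0 A" "f\<^sub>0 ` A \<subseteq> {..<u}" "inj_on \<phi>\<^sub>0 {e\<in>hedges F. e \<subseteq> A}"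
    "\<forall>e. e \<in> hedges F \<longrightarrow> e \<subseteq> A \<longrightarrow> \<phi>\<^sub>0 e \<in> X \<and> f\<^sub>0 ` e \<subseteq> \<phi>\<^sub>0 e"
    using core_embedding[OF F A(1,3) pe] by (elim exE conjE)
  show ?thesis
  proof (rule sat_linear_of_free[OF F _ X(1) _ D(1) _ _ A(1,2) f0(1) _ f0(3) f0(4)[rule_format]])
    show "0 < k - r" using r(2) by simp
    show "c \<in> D c \<and> D c \<subseteq> {..<u} \<and> card (D c) + (k - r) = k" if "c < u" for c
      using D(2)[OF that] r(2) by simp
    show "e \<subseteq> {..<z} \<and> card e = k" if "e \<in> X" for e using X(2)[OF that] by simp
    show "f\<^sub>0 ` A \<subseteq> {..<z}" using f0(2) X(1) by auto
    show "f\<^sub>0 a < u" if "a \<in> A" for a using f0(2) that by auto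
    show "\<not> berge_emb F f \<phi> ({..<n}, main_edges z (k - r) D u n \<union> X)" for n f \<phi>
    proof
      assume "berge_emb F f \<phi> ({..<n}, main_edges z (k - r) D u n \<union> X)"
      then have "skeleton_embedding F f \<phi> z (k - r) u n D X"
        by unfold_locales (use F r(2) X(1,2) D(2) in \<open>auto simp: skeleton_def\<close>)
      then show False by (rule free) (use X(2,3,4) in auto)
    qed
  qed
qed

text \<open>The two-vertex core serves \<open>F\<close> without its triangle component, and three extra hyperedges
  away from the core provide that triangle.\<close>

lemma sat_linear_triangle_component:
  fixes F :: "'a hypergraph"
  assumes F: "graph F" and "triangle_component F T"
    and A: "A \<subseteq> verts F" "acyclic_on (hedges F) (verts F - A)" "card A \<le> 3"
    and fv: "\<And>A. A \<subseteq> verts F \<Longrightarrow> acyclic_on (hedges F) (verts F - A) \<Longrightarrow> 3 \<le> card A"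
  shows "(\<lambda>n. real (berge_sat 5 n F)) \<in> O[sequentially](\<lambda>n. real n)"
proof -
  have T: "T \<subseteq> verts F" "card T = 3"
      "\<And>x y. x \<in> T \<Longrightarrow> y \<in> T \<Longrightarrow> x \<noteq> y \<Longrightarrow> {x, y} \<in> hedges F"
      "\<And>e. e \<in> hedges F \<Longrightarrow> e \<inter> T \<noteq> {} \<Longrightarrow> e \<subseteq> T"
    using assms(2) unfolding triangle_component_def by auto
  have finT: "finite T" and finA: "finite A"
    using T(1) A(1) graph_finite(1)[OF F] by (auto intro: finite_subset)
  have tcT: "two_core (hedges F) T"
    unfolding two_core_def
  proof (intro conjI ballI)
    show "T \<noteq> {}" using T(2) by auto
    fix x assume x: "x \<in> T"
    then have "card (T - {x}) = 2" using T(2) by simp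
    then obtain y y' where "T - {x} = {y, y'}" "y \<noteq> y'" by (auto simp: card_2_iff)
    then have "y \<in> T" "y' \<in> T" "x \<noteq> y" "x \<noteq> y'" by auto
    then show "\<exists>y\<in>T. \<exists>z\<in>T. y \<noteq> z \<and> {x, y} \<in> hedges F \<and> {x, z} \<in> hedges F"
      using T(3)[OF x] \<open>y \<noteq> y'\<close> by auto
  qed
  \<comment> \<open>\<open>T\<close> is a 2-core, so \<open>A\<close> must meet it; the rest of
    \<open>A\<close> then fits into a core of two vertices.\<close>
  have "A \<inter> T \<noteq> {}"
  proof
    assume "A \<inter> T = {}"
    then have "T \<subseteq> verts F - A" using T(1) by auto
    then show False using A(2) tcT by (auto simp: acyclic_on_def)
  qed
  then have "card (A - T) < card A" using finA by (intro psubset_card_mono) auto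
  then have cB: "card (A - T) \<le> 2" using A(3) by simp
  let ?B = "A - T"
  have BV: "?B \<subseteq> verts F" using A(1) by auto
  obtain z X ext where pe: "pair_edges 2 2 5 z X ext" using pair_edges_exist[of 2 2 5] by auto
  note pX = pair_edgesD[OF pe]
  obtain f\<^sub>0 \<phi>\<^sub>0 where f0: "inj_on f\<^sub>0 ?B" "f\<^sub>0 ` ?B \<subseteq> {..<2}" "inj_on \<phi>\<^sub>0 {e\<in>hedges F. e \<subseteq> ?B}"
    "\<forall>e. e \<in> hedges F \<longrightarrow> e \<subseteq> ?B \<longrightarrow> \<phi>\<^sub>0 e \<in> X \<and> f\<^sub>0 ` e \<subseteq> \<phi>\<^sub>0 e"
    using core_embedding[OF F BV cB pe] by (elim exE conjE)
  obtain f\<^sub>1 where f1: "f\<^sub>1 ` T \<subseteq> {z..<z + 3}" "inj_on f\<^sub>1 T"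
    using card_le_inj[of T "{z..<z + 3}"] finT T(2) by auto
  let ?ET = "{e\<in>hedges F. e \<subseteq> T}"
  have "card ?ET \<le> card {e. e \<subseteq> T \<and> card e = 2}"
    using F finT by (intro card_mono) (auto simp: graph_def uniform_def)
  also have "\<dots> = 3" using n_subsets[OF finT, of 2] T(2) by (simp add: choose_two)
  finally obtain g where g: "g ` ?ET \<subseteq> {..<3::nat}" "inj_on g ?ET"
    using card_le_inj[of ?ET "{..<3::nat}"] graph_finite(2)[OF F] by auto
  \<comment> \<open>The three hyperedges share four vertices, among them the images of
    \<open>T\<close>, and have one private vertex each. Any edge of \<open>T\<close> thus fits into
    any of them, and they occupy the seven vertices from \<open>z\<close> on.\<close>
  define G where "G = (\<lambda>i. {z..<z + 4} \<union> {z + 4 + i}) ` {..<3::nat}"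
  let ?\<phi>\<^sub>1 = "\<lambda>e. {z..<z + 4} \<union> {z + 4 + g e}"
  define f where "f = (\<lambda>v. if v \<in> T then f\<^sub>1 v else f\<^sub>0 v)"
  define \<phi> where "\<phi> = (\<lambda>e. if e \<subseteq> T then ?\<phi>\<^sub>1 e else \<phi>\<^sub>0 e)"
  have Gz: "e \<subseteq> {z..<z + 7} \<and> card e = 5" if "e \<in> G" for e
    using that by (auto simp: G_def)
  have ne: "e \<noteq> {}" if "e \<in> hedges F" for e using F that by (force simp: graph_def uniform_def)
  have edge: "e \<subseteq> T \<or> e \<subseteq> ?B \<and> \<not> e \<subseteq> T" if "e \<in> hedges F" "e \<subseteq> ?B \<union> T" for e
    using T(4)[OF that(1)] that(2) ne[OF that(1)] by blast
  have phi0X: "\<phi> e \<in> X \<and> \<phi> e = \<phi>\<^sub>0 e" if "e \<in> hedges F" "e \<subseteq> ?B" "\<not> e \<subseteq> T" for e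
    using f0(4)[rule_format, OF that(1,2)] that(3) by (simp add: \<phi>_def)
  have phi1G: "\<phi> e \<in> G \<and> \<phi> e = ?\<phi>\<^sub>1 e" if "e \<in> hedges F" "e \<subseteq> T" for e
    using g(1) that by (auto simp: \<phi>_def G_def)
  have XG: "X \<inter> G = {}" using pX(2) by (fastforce simp: G_def)
  show ?thesis
  \<comment> \<open>The set embedded beforehand is \<open>A\<close> together with all of
    \<open>T\<close>. No edge leaves \<open>T\<close>, so mixed edges start in \<open>A - T\<close>,
    which is mapped into the core.\<close>
  proof (rule sat_linear_of_free[OF F, where b = 4 and u = 2 and z = "z + 7" and D = "\<lambda>c. {c}"
        and X = "X \<union> G" and A = "?B \<union> T" and f\<^sub>0 = f and \<phi>\<^sub>0 = \<phi>])
    show "0 < (4::nat)" "2 \<le> z + 7" "inj_on (\<lambda>c::nat. {c}) {..<2}"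
      "\<And>c::nat. c < 2 \<Longrightarrow> c \<in> {c} \<and> {c} \<subseteq> {..<2} \<and> card {c} + 4 = 5"
      using pX(1) by auto
    show "?B \<union> T \<subseteq> verts F" using A(1) T(1) by auto
    show "acyclic_on (hedges F) (verts F - (?B \<union> T))" by (rule acyclic_on_subset[OF A(2)]) auto
    show "e \<subseteq> {..<z + 7} \<and> card e = 5" if "e \<in> X \<union> G" for e
    proof (cases "e \<in> X")
      case True
      then show ?thesis using pX(2) by fastforce
    next
      case False
      then show ?thesis using Gz[of e] that by auto
    qed
    show "inj_on f (?B \<union> T)"
    proof (rule inj_onI)
      fix v w assume vw: "v \<in> ?B \<union> T" "w \<in> ?B \<union> T" "f v = f w"
      have lo: "f x < z" if "x \<in> ?B" for x using f0(2) pX(1) that by (fastforce simp: f_def)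
      have hi: "z \<le> f x" if "x \<in> T" for x using f1(1) that by (fastforce simp: f_def)
      consider "v \<in> ?B" "w \<in> ?B" | "v \<in> T" "w \<in> T"
        using vw lo[of v] lo[of w] hi[of v] hi[of w] by (metis UnE not_le)
      then show "v = w"
      proof cases
        case 1
        then show ?thesis using inj_onD[OF f0(1), of v w] vw(3) by (auto simp: f_def)
      next
        case 2
        then show ?thesis using inj_onD[OF f1(2), of v w] vw(3) by (auto simp: f_def)
      qed
    qed
    show "f ` (?B \<union> T) \<subseteq> {..<z + 7}"
      using f0(2) f1(1) pX(1) by (fastforce simp: f_def)
    show "inj_on \<phi> {e\<in>hedges F. e \<subseteq> ?B \<union> T}"
    proof (rule inj_onI)
      fix e e' assume e: "e \<in> {e\<in>hedges F. e \<subseteq> ?B \<union> T}" "e' \<in> {e\<in>hedges F. e \<subseteq> ?B \<union> T}" "\<phi> e = \<phi> e'"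
      show "e = e'"
      proof (cases "e \<subseteq> T")
        case True
        then have eG: "\<phi> e \<in> G" "\<phi> e = ?\<phi>\<^sub>1 e" using phi1G[of e] e(1) by blast+
        have T': "e' \<subseteq> T"
        proof (rule ccontr)
          assume "\<not> e' \<subseteq> T"
          then have "\<phi> e' \<in> X" using edge[of e'] phi0X[of e'] e(2) by auto
          then show False using eG(1) e(3) XG by auto
        qed
        have "\<phi> e' = ?\<phi>\<^sub>1 e'" using phi1G[of e'] T' e(2) by blast
        then have "?\<phi>\<^sub>1 e = ?\<phi>\<^sub>1 e'" using eG(2) e(3) by metis
        then have "z + 4 + g e \<in> ?\<phi>\<^sub>1 e'" by blast
        then have "g e = g e'" by auto
        then show ?thesis using inj_onD[OF g(2), of e e'] e True T' by auto
      next
        case False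
        then have eX: "e \<subseteq> ?B" "\<phi> e \<in> X" "\<phi> e = \<phi>\<^sub>0 e" using edge[of e] phi0X[of e] e(1) by auto
        have T': "\<not> e' \<subseteq> T" using phi1G[of e'] eX(2) e(2,3) XG by auto
        have e'H: "e' \<in> hedges F" "e' \<subseteq> ?B \<union> T" using e(2) by blast+
        then have e'B: "e' \<subseteq> ?B" using edge[OF e'H] T' by blast
        then have "\<phi> e' = \<phi>\<^sub>0 e'" using phi0X[OF e'H(1) _ T'] by blast
        then have "\<phi>\<^sub>0 e = \<phi>\<^sub>0 e'" using eX(3) e(3) by metis
        moreover have "e \<in> hedges F" using e(1) by blast
        ultimately show ?thesis using inj_onD[OF f0(3), of e e'] eX(1) e'H(1) e'B by blast
      qed
    qed
    show "\<phi> e \<in> X \<union> G \<and> f ` e \<subseteq> \<phi> e" if e: "e \<in> hedges F" "e \<subseteq> ?B \<union> T" for e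
    proof (cases "e \<subseteq> T")
      case True
      then have "f ` e \<subseteq> {z..<z + 3}" using f1(1) by (auto simp: f_def)
      also have "\<dots> \<subseteq> ?\<phi>\<^sub>1 e" by auto
      finally show ?thesis using phi1G[OF e(1) True] by (metis UnI2)
    next
      case False
      then have eB: "e \<subseteq> ?B" using edge[OF e] by blast
      then have "f ` e = f\<^sub>0 ` e" by (intro image_cong) (auto simp: f_def)
      then show ?thesis using phi0X[OF e(1) eB False] f0(4)[rule_format, OF e(1) eB] by simp
    qed
    show "f a < 2" if "e \<in> hedges F" "\<not> e \<subseteq> ?B \<union> T" "a \<in> e" "a \<in> ?B \<union> T" for e a
    proof -
      have "a \<notin> T" using T(4)[OF that(1)] that(2,3) by auto
      then show ?thesis using that(4) f0(2) by (auto simp: f_def)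
    qed
    show "\<not> berge_emb F f' \<phi>' ({..<n}, main_edges (z + 7) 4 (\<lambda>c. {c}) 2 n \<union> (X \<union> G))" for n f' \<phi>'
    proof
      assume emb: "berge_emb F f' \<phi>' ({..<n}, main_edges (z + 7) 4 (\<lambda>c. {c}) 2 n \<union> (X \<union> G))"
      interpret skeleton_embedding F f' \<phi>' "z + 7" 4 2 n "\<lambda>c. {c}" "X \<union> G"
      proof
        show "e \<subseteq> {..<z + 7}" if "e \<in> X \<union> G" for e using that pX(2)[of e] Gz[of e] by fastforce
      qed (use F pX(1) emb in \<open>auto simp: skeleton_def\<close>)
      have "card G \<le> card {..<3::nat}" unfolding G_def by (rule card_image_le) simp
      moreover have "v < 2 \<or> e = e'" if "e \<in> X" "e' \<in> X \<union> G" "v \<in> e" "v \<in> e'" for e e' v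
      proof (cases "e' \<in> X")
        case True
        then show ?thesis using pX(3) that by (auto simp: private_outside_def)
      next
        case False
        then show ?thesis using Gz[of e'] pX(2)[of e] that by fastforce
      qed
      ultimately show False using no_embedding_gadget[of X G] fv by (auto simp: G_def)
    qed
  qed
qed

text \<open>No saturated hypergraph exists here, and any value of \<open>Inf {}\<close> is a constant.\<close>

lemma berge_sat_edgeless:
  assumes "hedges F = {}" "finite (verts F)" "card (verts F) \<le> n"
  shows "berge_sat k n F = Inf {}"
proof -
  have "contains_berge F H" if H: "hypergraph H" "card (verts H) = n" for H :: "nat hypergraph"
  proof -
    have "finite (verts H)" using H(1) by (simp add: hypergraph_def)
    then obtain f where "f ` verts F \<subseteq> verts H" "inj_on f (verts F)"
      using card_le_inj[of "verts F" "verts H"] assms H(2) by auto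
    then have "berge_emb F f (\<lambda>_. {}) H" using assms(1) by (simp add: berge_emb_def)
    then show ?thesis using contains_berge_iff[OF H(1)] by blast
  qed
  then have "{card (hedges H) | H :: nat hypergraph. card (verts H) = n \<and> berge_saturated k F H} = {}"
    by (auto simp: berge_saturated_def)
  then show ?thesis by (simp only: berge_sat_def)
qed

theorem theorem1:
  fixes F :: "'a hypergraph" and k :: nat
  assumes "graph F" and "3 \<le> k" and "k \<le> 5"
  shows "(\<lambda>n. real (berge_sat k n F)) \<in> O[sequentially](\<lambda>n. real n)"
proof (cases "hedges F = {}")
  case True
  show ?thesis
  \<comment> \<open>\<open>Suc\<close> ensures n \<ge> 1, so that a constant is at most itself times
    \<open>n\<close>.\<close>
  proof (rule bigoI[of _ "real (Inf {})"], rule eventually_sequentiallyI[of "Suc (card (verts F))"])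
    fix n assume "Suc (card (verts F)) \<le> n"
    then show "norm (real (berge_sat k n F)) \<le> real (Inf {}) * norm (real n)"
      using berge_sat_edgeless[OF True graph_finite(1)[OF assms(1)], of n k]
      by (simp add: mult_le_cancel_left1)
  qed
next
  case False
  let ?V = "verts F" and ?E = "hedges F"
  note F = assms(1) and k = assms(2,3)
  have fin: "finite ?V" by (rule graph_finite[OF F])
  have "vertex_cover ?E ?V"
    using graph_edge[OF F] unfolding vertex_cover_def by blast
  then obtain W where W: "W \<subseteq> ?V" "vertex_cover ?E W"
    and Wmin: "\<And>W'. W' \<subseteq> ?V \<Longrightarrow> vertex_cover ?E W' \<Longrightarrow> card W \<le> card W'"
    using ex_has_least_nat[of "\<lambda>W. W \<subseteq> ?V \<and> vertex_cover ?E W" ?V card] by auto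
  have finW: "finite W" using W(1) fin by (rule finite_subset)
  obtain w where w: "w \<in> W" using False W(2) by (auto simp: vertex_cover_def)
  have "acyclic_on ?E (?V - ?V)" by (auto simp: acyclic_on_def two_core_def)
  then obtain A where A: "A \<subseteq> ?V" "acyclic_on ?E (?V - A)"
    and Amin: "\<And>A'. A' \<subseteq> ?V \<Longrightarrow> acyclic_on ?E (?V - A') \<Longrightarrow> card A \<le> card A'"
    using ex_has_least_nat[of "\<lambda>A. A \<subseteq> ?V \<and> acyclic_on ?E (?V - A)" ?V card] by auto
  have Ww: "W - {w} \<subseteq> ?V" "acyclic_on ?E (?V - (W - {w}))" "card (W - {w}) = card W - 1"
    using W(1) acyclic_on_cover_minus[OF F W(2)] w finW by auto
  have AW: "card A \<le> card W - 1" using Amin[OF Ww(1,2)] Ww(3) by simp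
  have W0: "0 < card W" using w finW card_gt_0_iff by blast
  \<comment> \<open>If \<tau> \<le> k, then u \<le> \<tau> - 1 \<le> k - 1 \<le> 4, so u = 3 forces
    k \<ge> 4 and u = 4 forces k = 5.\<close>
  consider "k < card W" | "card A \<le> 2" | "card A = 3" "4 \<le> k" "card W < 6" "k = 5 \<Longrightarrow> \<nexists>T. triangle_component F T"
    | T where "card A = 3" "k = 5" "triangle_component F T"
    | "card A = 4" "k = 5" "card W < 6"
  proof -
    consider "k < card W" | "card A \<le> 2" | "card A = 3" "4 \<le> k" "card W < 6"
      | "card A = 4" "k = 5" "card W < 6"
      using AW W0 k by linarith
    then show ?thesis using that by cases metis+
  qed
  then show ?thesis
  proof cases
    case 1
    show ?thesis
    \<comment> \<open>\<open>W - {w}\<close> replaces the minimal \<open>A\<close>, and r = k - 1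
      gives blocks of size one.\<close>
    proof (rule sat_linear_of_no_embedding[OF F _ _ _ k(1) Ww(1,2), of "k - 1" "card W - 1"])
      show "1 \<le> k - 1" "k - 1 < k" "k - 1 = 1 \<or> k - 1 < card W - 1" "card (W - {w}) \<le> card W - 1"
        using 1 k Ww(3) by auto
      fix f \<phi> z n D X
      assume s: "skeleton_embedding F f \<phi> z (k - (k - 1)) (card W - 1) n D X"
        and X: "\<And>e. e \<in> X \<Longrightarrow> card (e - {..<card W - 1}) = k - max 2 (k - 1)"
      show False
      proof (rule skeleton_embedding.no_embedding_single_outside[OF s])
        show "k - (k - 1) = 1" using k by simp
        show "card (e - {..<card W - 1}) \<le> 1" if "e \<in> X" for e using X[OF that] k by simp
        show "card W - 1 < card W'" if "W' \<subseteq> ?V" "vertex_cover ?E W'" for W'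
          using Wmin[OF that] W0 by simp
      qed
    qed
  next
    case 2
    show ?thesis
    \<comment> \<open>With u \<le> 2 the sets \<open>D c\<close> have to be singletons.\<close>
    proof (rule sat_linear_of_no_embedding[OF F _ _ _ k(1) A order_refl, of 1])
      show "1 \<le> (1::nat)" "1 < k" "(1::nat) = 1 \<or> 1 < card A" using k by auto
      fix f \<phi> z n D X
      assume s: "skeleton_embedding F f \<phi> z (k - 1) (card A) n D X"
        and priv: "private_outside (card A) X" and X0: "card A = 0 \<Longrightarrow> X = {}"
      interpret skeleton_embedding F f \<phi> z "k - 1" "card A" n D X by (rule s)
      show False
      proof (cases "card A = 0")
        \<comment> \<open>\<open>F\<close> is a forest with an edge, while the skeleton is
          empty.\<close>
        case c0: True
        then have "skeleton z (k - 1) D (card A) n X = {}"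
          using X0[OF c0] by (simp add: skeleton_def main_edges_def)
        then show ?thesis using embD(3) False by auto
      next
        case False
        then show ?thesis using no_embedding_core_le_two[OF _ 2 priv Amin] by simp
      qed
    qed
  next
    case 3
    show ?thesis
    \<comment> \<open>r = 2 is the largest choice below u = 3; the blocks have size 2 for k = 4 and
      size 3 for k = 5.\<close>
    proof (rule sat_linear_of_no_embedding[OF F _ _ _ k(1) A order_refl, of 2])
      show "1 \<le> (2::nat)" "2 < k" "(2::nat) = 1 \<or> 2 < card A" using k 3 by auto
      fix f \<phi> z n D X
      assume s: "skeleton_embedding F f \<phi> z (k - 2) (card A) n D X"
        and priv: "private_outside (card A) X"
      interpret skeleton_embedding F f \<phi> z "k - 2" "card A" n D X by (rule s)
      show False
      proof (rule no_embedding_disjoint_clusters[OF _ priv Amin W(2) finW 3(3)])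
        fix S S' c c' t
        assume c: "c < card A" "c' < card A" "cluster S c t" "cluster S' c' t"
        show "c = c'"
        proof (cases "k = 5")
          case True
          then show ?thesis using clusters_disjoint_triples[OF _ 3(1) c 3(4)] by simp
        next
          case False
          then have "k - 2 = 2" using k 3(2) by simp
          then show ?thesis using clusters_disjoint_pairs[OF _ _ c] 3(1) by simp
        qed
      qed (use 3 in auto)
    qed
  next
    case (4 T)
    then show ?thesis
      using sat_linear_triangle_component[OF F 4(3) A] Amin by simp
  next
    case 5
    show ?thesis
    \<comment> \<open>r = 3 gives blocks of size 2 with four hyperedges each, one fewer than two
      clusters would need.\<close>
    proof (rule sat_linear_of_no_embedding[OF F _ _ _ k(1) A order_refl, of 3])
      show "1 \<le> (3::nat)" "3 < k" "(3::nat) = 1 \<or> 3 < card A" using 5 by auto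
      fix f \<phi> z n D X
      assume s: "skeleton_embedding F f \<phi> z (k - 3) (card A) n D X"
        and priv: "private_outside (card A) X"
      interpret skeleton_embedding F f \<phi> z "k - 3" "card A" n D X by (rule s)
      show False
        by (rule no_embedding_disjoint_clusters[OF _ priv Amin W(2) finW 5(3)])
          (use 5 clusters_disjoint_pairs in auto)
    qed
  qed
qed

end
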